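(* In the one-dimensional setting of the context, assume that $\mathtt F_p$ is one-dimensionally admissible for every $p\in(1,2)$ (with $\ell,\xi_1,\xi_2$ independent of $p$), that there is $\mathtt F_1\in C^{0,\theta}_{\mathrm{loc}}([0,\infty)^3)$, for some $\theta\in(0,1]$, with $\mathtt F_p\to\mathtt F_1$ locally uniformly in $[0,\infty)^3$ as $p\downarrow1$, and that $\frac{\beta_p}{p-1}\to\mathbf c\in[0,1]$ as $p\downarrow1$. Let $p_j\downarrow1$ and let $y_{p_j},k_{p_j},G_{p_j}$ be as in the context. After passing to a subsequence (not relabeled), there exist $y\in W^{1,\infty}_{\mathrm{loc}}([0,\infty))$, $G\in W^{1,\infty}_{\mathrm{loc}}([0,\infty))$ and $K\in L^\infty_{\mathrm{loc}}([0,\infty))$ such that: (i) $$y_{p_j}\to y\ \text{ in } C_{\mathrm{loc}}([0,\infty)),\qquad y_{p_j}'\stackrel{*}{\rightharpoonup}y'\ \text{ in } L^\infty_{\mathrm{loc}}(0,\infty),$$ $$G_{p_j}\to G\ \text{ in } C_{\mathrm{loc}}([0,\infty)),\qquad k_{p_j}\stackrel{*}{\rightharpoonup}K\ \text{ in } L^\infty_{\mathrm{loc}}(0,\infty),$$ $$G'=K\ge0,\qquad G(0)=0,\qquad 0\le G\le1,\qquad (1-G)y'=0\ \text{ a.e. on }(0,\infty).$$ (ii) Define $\mathscr C_1:=\{t>0\mid G(t)=1\}$. If $\mathscr C_1\ne\emptyset$, then $G(t)<1$ for $0\le t<\inf\mathscr C_1$ and $G(t)=1$ for $t\ge\inf\mathscr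 C_1$. Moreover, for every $r>0$ such that $G(r)<1$, $$y(t)=1,\qquad K(t)=G'(t)=\mathtt F_1(t,1,0)\quad\text{for a.e. }t\in(0,r).$$ If $\mathscr C_1\ne\emptyset$, then $K(t)=0$ for a.e. $t\in(\inf\mathscr C_1,\infty)$. Let $u(x):=y(|x|)$, $z(x):=\operatorname{sign}(x)G(|x|)$, $z(0):=0$. Then $$\Delta_1u=K(|x|)\quad\text{in }\mathbb R$$ in the sense defined in the context. (iii) Assume that $\mathscr C_1\ne\emptyset$, and let $E\subset(\inf\mathscr C_1,\infty)$ be measurable. Suppose that $$a(t):=\lim_{j\to\infty}\frac{G_{p_j}(t)-1}{p_j-1}\in\mathbb R\quad\text{(exists and is finite) for a.e. }t\in E.$$ Then $y'(t)=e^{a(t)}$ and $\mathtt F_1(t,y(t),y'(t))=0$ for a.e. $t\in E$.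
   Context: **One-dimensional setting.** Let $\ell\ge0$, $\xi_1\ge1$, $\xi_2>0$ be constants independent of $p$; put $\varphi(t):=\max\{\ell,t\}$, $U(t):=\xi_1(1+\varphi(t))$, $m_\xi:=\min\{\xi_1,\xi_2\}$. For each $p\in(1,2)$ let $0\le\beta_p\le p-1$ and $\mathtt F_p:[0,\infty)^3\to\mathbb R$. $\mathtt F_p$ is *one-dimensionally admissible* if (a) there is $\theta\in(0,1]$ with $\mathtt F_p\in C^{0,\theta}_{\mathrm{loc}}([0,\infty)^3)$, and $\mathtt F_p\ge0$; (b) for every $t\ge0$, $u\mapsto\mathtt F_p(t,u,s)$ is nondecreasing on $[1,U(t)]$ for every $s\in[0,\xi_2]$, and $s\mapsto\mathtt F_p(t,u,s)$ is nondecreasing on $[0,\xi_2]$ for every $u\in[1,U(t)]$; (c) $\int_0^\infty\mathtt F_p(t,U(t),\xi_2)\,dt\le m_\xi^{p-1}$. **Solutions.** For $p\in(1,2)$, $u_p(x)=y_p(|x|)$ is an even positive classical solution of $(|u'|^{p-2}u')'=\mathtt F_p(|x|,u,|u'|)u^{-\beta_p}$ on $\mathbb R$ (i.e. $u\in C^1(\mathbb R)$, $|u'|^{p-2}u'\in C^1(\mathbb R)$) with $y_p(0)=1$, $y_p'(0)=0$, $1\le y_p(t)\le U(t)$, $0\le y_p'(t)\le\xi_2$ for $t\ge0$ (such a solution exists when $\mathtt F_p$ is one-dimensionally admissible). Put $$k_p(t):=\mathtt F_p(t,y_p(t),y_p'(t))y_p(t)^{-\beta_p},\qquad G_p(t):=\int_0^t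 k_p(s)\,ds=y_p'(t)^{p-1}.$$ **Conventions.** $f_j\stackrel{*}{\rightharpoonup}f$ in $L^\infty_{\mathrm{loc}}(\Omega)$ means $\int_V f_j\psi\,dt\to\int_V f\psi\,dt$ for every open $V\Subset\Omega$ and $\psi\in L^1(V)$. $W^{1,\infty}_{\mathrm{loc}}([0,\infty))$ and $L^\infty_{\mathrm{loc}}([0,\infty))$ mean membership in the corresponding space on $(0,R)$ for every $R>0$. **1-Laplacian on $\mathbb R$.** For $z\in L^\infty_{\mathrm{loc}}(\mathbb R)$ with $z'\in L^\infty_{\mathrm{loc}}(\mathbb R)$ and $u\in BV_{\mathrm{loc}}(\mathbb R)\cap L^\infty_{\mathrm{loc}}(\mathbb R)$, $(z,Du)$ is the Radon measure given by $\langle(z,Du),\zeta\rangle=-\int u\zeta z'\,dx-\int uz\zeta'\,dx$, $\zeta\in C_c^\infty(\mathbb R)$. For such $u$ and $f\in L^\infty_{\mathrm{loc}}(\mathbb R)$, $\Delta_1u=f$ (i.e. $-\Delta_1u=-f$) means: there is $z\in L^\infty_{\mathrm{loc}}(\mathbb R)$ with $z'\in L^\infty_{\mathrm{loc}}(\mathbb R)$, $z'=f$ in distributions, $|z|\le1$ a.e., and $(z,Du)=|Du|$ as Radon measures, where $|Du|$ is the total variation measure of $Du$. *)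

theory Defs
  imports "HOL-Analysis.Analysis"
begin

section \<open>Function spaces and weak convergence\<close>

text \<open>The argument \<open>(t, u, s)\<close> of a nonlinearity ranges over \<open>[0,\<infinity>)\<^sup>3\<close>; values of the total
  functions of HOL outside this set are never used.\<close>

abbreviation orthant3 :: "(real \<times> real \<times> real) set" where
  "orthant3 \<equiv> {0..} \<times> {0..} \<times> {0..}"

definition holder_loc :: "real \<Rightarrow> 'a::metric_space set \<Rightarrow> ('a \<Rightarrow> real) \<Rightarrow> bool" where
  "holder_loc \<theta> S f \<longleftrightarrow>
     (\<forall>C. compact C \<and> C \<subseteq> S \<longrightarrow> (\<exists>L. \<forall>a\<in>C. \<forall>b\<in>C. \<bar>f a - f b\<bar> \<le> L * dist a b powr \<theta>))"

definition compactly_inside :: "real set \<Rightarrow> real set \<Rightarrow> bool" where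
  "compactly_inside V \<Omega> \<longleftrightarrow> open V \<and> compact (closure V) \<and> closure V \<subseteq> \<Omega>"

text \<open>\<open>C\<^sub>c\<^sup>\<infinity>(\<Omega>)\<close>, as functions on the line vanishing off a compact subset of \<open>\<Omega>\<close>.\<close>

definition test_fun :: "real set \<Rightarrow> (real \<Rightarrow> real) \<Rightarrow> bool" where
  "test_fun \<Omega> \<zeta> \<longleftrightarrow>
     (\<forall>n x. (deriv ^^ n) \<zeta> field_differentiable at x) \<and>
     compact (closure {x. \<zeta> x \<noteq> 0}) \<and> closure {x. \<zeta> x \<noteq> 0} \<subseteq> \<Omega>"

definition L1_loc :: "real set \<Rightarrow> (real \<Rightarrow> real) \<Rightarrow> bool" where
  "L1_loc \<Omega> f \<longleftrightarrow> (\<forall>V. compactly_inside V \<Omega> \<longrightarrow> set_integrable lebesgue V f)"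

definition Linf :: "real set \<Rightarrow> (real \<Rightarrow> real) \<Rightarrow> bool" where
  "Linf \<Omega> f \<longleftrightarrow> set_borel_measurable lebesgue \<Omega> f \<and> (\<exists>B. AE x\<in>\<Omega> in lebesgue. \<bar>f x\<bar> \<le> B)"

definition Linf_loc :: "real set \<Rightarrow> (real \<Rightarrow> real) \<Rightarrow> bool" where
  "Linf_loc \<Omega> f \<longleftrightarrow> (\<forall>V. compactly_inside V \<Omega> \<longrightarrow> Linf V f)"

definition weak_deriv :: "real set \<Rightarrow> (real \<Rightarrow> real) \<Rightarrow> (real \<Rightarrow> real) \<Rightarrow> bool" where
  "weak_deriv \<Omega> f g \<longleftrightarrow> L1_loc \<Omega> f \<and> L1_loc \<Omega> g \<and>
     (\<forall>\<zeta>. test_fun \<Omega> \<zeta> \<longrightarrow>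
        (LINT x:\<Omega>|lebesgue. f x * deriv \<zeta> x) = - (LINT x:\<Omega>|lebesgue. g x * \<zeta> x))"

definition W1inf :: "real set \<Rightarrow> (real \<Rightarrow> real) \<Rightarrow> bool" where
  "W1inf \<Omega> f \<longleftrightarrow> Linf \<Omega> f \<and> (\<exists>g. Linf \<Omega> g \<and> weak_deriv \<Omega> f g)"

text \<open>\<open>L\<^sup>\<infinity>\<^sub>l\<^sub>o\<^sub>c([0,\<infinity>))\<close> and \<open>W\<^sup>1\<^sup>,\<^sup>\<infinity>\<^sub>l\<^sub>o\<^sub>c([0,\<infinity>))\<close>: bounds reach up to the origin, in contrast to
  \<open>Linf_loc {0<..}\<close>.\<close>

definition Linf_loc_halfline :: "(real \<Rightarrow> real) \<Rightarrow> bool" where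
  "Linf_loc_halfline f \<longleftrightarrow> (\<forall>R>0. Linf {0<..<R} f)"

definition W1inf_loc_halfline :: "(real \<Rightarrow> real) \<Rightarrow> bool" where
  "W1inf_loc_halfline f \<longleftrightarrow> (\<forall>R>0. W1inf {0<..<R} f)"

definition weakstar_loc :: "real set \<Rightarrow> (nat \<Rightarrow> real \<Rightarrow> real) \<Rightarrow> (real \<Rightarrow> real) \<Rightarrow> bool" where
  "weakstar_loc \<Omega> f g \<longleftrightarrow> (\<forall>j. Linf_loc \<Omega> (f j)) \<and> Linf_loc \<Omega> g \<and>
     (\<forall>V \<psi>. compactly_inside V \<Omega> \<and> set_integrable lebesgue V \<psi> \<longrightarrow>
        (\<lambda>j. LINT t:V|lebesgue. f j t * \<psi> t) \<longlonglongrightarrow> (LINT t:V|lebesgue. g t * \<psi> t))"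

definition locally_uniform_limit ::
  "'a::topological_space set \<Rightarrow> ('i \<Rightarrow> 'a \<Rightarrow> real) \<Rightarrow> ('a \<Rightarrow> real) \<Rightarrow> 'i filter \<Rightarrow> bool" where
  "locally_uniform_limit S f g \<F> \<longleftrightarrow> (\<forall>C. compact C \<and> C \<subseteq> S \<longrightarrow> uniform_limit C f g \<F>)"


section \<open>The \<open>1\<close>-Laplacian on the line\<close>

text \<open>The variation of \<open>u\<close> on an open set. The map \<open>ennreal\<close> truncates negative values to \<open>0\<close>, which
  does not affect the supremum because \<open>\<zeta> = 0\<close> is admitted.\<close>

definition variation :: "(real \<Rightarrow> real) \<Rightarrow> real set \<Rightarrow> ennreal" where
  "variation u V =
     (SUP \<zeta>\<in>{\<zeta>. test_fun V \<zeta> \<and> (\<forall>x. \<bar>\<zeta> x\<bar> \<le> 1)}. ennreal (LINT x|lebesgue. u x * deriv \<zeta> x))"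

definition BV_loc :: "(real \<Rightarrow> real) \<Rightarrow> bool" where
  "BV_loc u \<longleftrightarrow> L1_loc UNIV u \<and> (\<forall>V. compactly_inside V UNIV \<longrightarrow> variation u V < \<infinity>)"

text \<open>The Borel measure \<open>|Du|\<close>: the variation on open sets, extended by outer regularity. It is used
  only for \<open>u\<close> in \<open>BV\<^sub>l\<^sub>o\<^sub>c\<close>, where this set function is countably additive on Borel sets.\<close>

definition total_variation_measure :: "(real \<Rightarrow> real) \<Rightarrow> real measure" where
  "total_variation_measure u =
     measure_of UNIV (sets borel) (\<lambda>B. INF V\<in>{V. open V \<and> B \<subseteq> V}. variation u V)"

text \<open>The functional \<open>\<langle>(z,Du),\<zeta>\<rangle>\<close>; the argument \<open>dz\<close> is the distributional derivative of \<open>z\<close>.\<close>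

definition pairing ::
  "(real \<Rightarrow> real) \<Rightarrow> (real \<Rightarrow> real) \<Rightarrow> (real \<Rightarrow> real) \<Rightarrow> (real \<Rightarrow> real) \<Rightarrow> real" where
  "pairing z dz u \<zeta> =
     - (LINT x|lebesgue. u x * \<zeta> x * dz x) - (LINT x|lebesgue. u x * z x * deriv \<zeta> x)"

text \<open>\<open>z\<close> is a vector field realising \<open>\<Delta>\<^sub>1 u = f\<close>. As \<open>z' = f\<close>, the pairing is formed with \<open>f\<close>.
  Signed Radon measures on the line are identified with the functionals they induce on
  \<open>C\<^sub>c\<^sup>\<infinity>(\<real>)\<close>.\<close>

definition one_laplacian_field ::
  "(real \<Rightarrow> real) \<Rightarrow> (real \<Rightarrow> real) \<Rightarrow> (real \<Rightarrow> real) \<Rightarrow> bool" where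
  "one_laplacian_field z u f \<longleftrightarrow>
     Linf_loc UNIV z \<and> Linf_loc UNIV f \<and> weak_deriv UNIV z f \<and>
     (AE x in lebesgue. \<bar>z x\<bar> \<le> 1) \<and>
     (\<forall>\<zeta>. test_fun UNIV \<zeta> \<longrightarrow>
        pairing z f u \<zeta> = (LINT x|total_variation_measure u. \<zeta> x))"

definition one_laplacian :: "(real \<Rightarrow> real) \<Rightarrow> (real \<Rightarrow> real) \<Rightarrow> bool" where
  "one_laplacian u f \<longleftrightarrow> BV_loc u \<and> Linf_loc UNIV u \<and> (\<exists>z. one_laplacian_field z u f)"


section \<open>The one-dimensional problem\<close>

definition U_bound :: "real \<Rightarrow> real \<Rightarrow> real \<Rightarrow> real" where
  "U_bound l \<xi>1 t = \<xi>1 * (1 + max l t)"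

text \<open>The integral in the last condition is that of a nonnegative function and is therefore taken in
  \<open>[0,\<infinity>]\<close>, so that integrability is part of the condition.\<close>

definition one_dim_admissible ::
  "real \<Rightarrow> real \<Rightarrow> real \<Rightarrow> real \<Rightarrow> (real \<times> real \<times> real \<Rightarrow> real) \<Rightarrow> bool" where
  "one_dim_admissible l \<xi>1 \<xi>2 p F \<longleftrightarrow>
     (\<exists>\<theta>. 0 < \<theta> \<and> \<theta> \<le> 1 \<and> holder_loc \<theta> orthant3 F) \<and>
     (\<forall>a\<in>orthant3. 0 \<le> F a) \<and>
     (\<forall>t\<ge>0.
        (\<forall>s\<in>{0..\<xi>2}. mono_on {1..U_bound l \<xi>1 t} (\<lambda>u. F (t, u, s))) \<and>
        (\<forall>u\<in>{1..U_bound l \<xi>1 t}. mono_on {0..\<xi>2} (\<lambda>s. F (t, u, s)))) \<and>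
     (\<integral>\<^sup>+t\<in>{0..}. ennreal (F (t, U_bound l \<xi>1 t, \<xi>2)) \<partial>lborel) \<le> ennreal (min \<xi>1 \<xi>2 powr (p - 1))"

text \<open>The derivative of a function on \<open>[0,\<infinity>)\<close>, one-sided at the origin.\<close>

definition hderiv :: "(real \<Rightarrow> real) \<Rightarrow> real \<Rightarrow> real" where
  "hderiv y t = vector_derivative y (at t within {0..})"

definition classical_solution ::
  "real \<Rightarrow> real \<Rightarrow> (real \<times> real \<times> real \<Rightarrow> real) \<Rightarrow> (real \<Rightarrow> real) \<Rightarrow> bool" where
  "classical_solution p b F u \<longleftrightarrow>
     u C1_differentiable_on UNIV \<and>
     (\<lambda>x. \<bar>deriv u x\<bar> powr (p - 2) * deriv u x) C1_differentiable_on UNIV \<and>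
     (\<forall>x. deriv (\<lambda>x. \<bar>deriv u x\<bar> powr (p - 2) * deriv u x) x
            = F (\<bar>x\<bar>, u x, \<bar>deriv u x\<bar>) * u x powr (- b))"

text \<open>\<open>y\<close> is the profile of an even positive classical solution \<open>x \<mapsto> y(|x|)\<close> with the prescribed
  initial values and bounds.\<close>

definition solution_profile ::
  "real \<Rightarrow> real \<Rightarrow> real \<Rightarrow> real \<Rightarrow> real \<Rightarrow> (real \<times> real \<times> real \<Rightarrow> real) \<Rightarrow> (real \<Rightarrow> real) \<Rightarrow> bool" where
  "solution_profile l \<xi>1 \<xi>2 p b F y \<longleftrightarrow>
     (\<forall>x. 0 < y \<bar>x\<bar>) \<and> classical_solution p b F (\<lambda>x. y \<bar>x\<bar>) \<and>
     y 0 = 1 \<and> hderiv y 0 = 0 \<and>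
     (\<forall>t\<ge>0. 1 \<le> y t \<and> y t \<le> U_bound l \<xi>1 t \<and> 0 \<le> hderiv y t \<and> hderiv y t \<le> \<xi>2)"

definition k_fun ::
  "(real \<times> real \<times> real \<Rightarrow> real) \<Rightarrow> real \<Rightarrow> (real \<Rightarrow> real) \<Rightarrow> real \<Rightarrow> real" where
  "k_fun F b y t = F (t, y t, hderiv y t) * y t powr (- b)"

definition G_fun ::
  "(real \<times> real \<times> real \<Rightarrow> real) \<Rightarrow> real \<Rightarrow> (real \<Rightarrow> real) \<Rightarrow> real \<Rightarrow> real" where
  "G_fun F b y t = integral {0..t} (k_fun F b y)"

end

theory Submission
  imports Defs "HOL-Probability.Helly_Selection"
begin

text \<open>Since \<open>G\<^sub>p = (y\<^sub>p')\<^sup>p\<^sup>-\<^sup>1\<close> is nondecreasing, so is \<open>y\<^sub>p'\<close>, and Helly's theorem selects a subsequence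
  along which \<open>y\<^sub>p'\<close> converges to a monotone \<open>w\<close> off a countable set \<open>D\<close>. All limits in (i) then follow
  by dominated convergence, with \<open>y = 1 + \<integral> w\<close>, \<open>K = F\<^sub>1(\<cdot>, y, w)\<close> and \<open>G = \<integral> K\<close>. Where \<open>w > 0\<close>,
  \<open>G = lim (y\<^sub>p')\<^sup>p\<^sup>-\<^sup>1 = 1\<close>, which is the complementarity \<open>(1 - G) w = 0\<close>; where \<open>G = 1\<close>, \<open>G\<close> is
  maximal, so \<open>K = G' = 0\<close>. Hence \<open>(1 - G)(y - 1) = 0\<close>, i.e. \<open>G y = G + (y - 1)\<close>, which linearises the product
  \<open>u z\<close> in the pairing, and \<open>(z, Du)\<close> and \<open>|Du|\<close> both have density \<open>w(|x|)\<close>.\<close>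

section \<open>Smooth functions approximating the sign\<close>

text \<open>Monotonicity is what makes the limit identifiable. The density \<open>k_p\<close>
  depends nonlinearly on \<open>y_p'\<close>, so weak-star convergence of the derivatives alone
  would not determine the limit of \<open>F_p (t, y_p, y_p')\<close>; pointwise convergence does. It
  also keeps the exceptional set countable. For t > 0 off \<open>D\<close> both \<open>w\<close> and
  \<open>K\<close> are continuous, so their primitives \<open>Y\<close> and \<open>G\<close> are
  differentiable there in the classical sense. Neither Lebesgue's differentiation theorem nor
  Rademacher's theorem enters, and each a.e. claim about the limit is proved at every admissible
  point off \<open>D\<close>. The measure |Du| is given by a supremum over smooth test functions on
  open sets and then by outer regularity. To compute it, one needs concrete smooth functions,
  compactly supported in an arbitrary open set, that tend to minus the sign of x. This is the origin
  of the functions built from exp(-1/s).\<close>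

definition exp_flat :: "nat \<Rightarrow> real \<Rightarrow> real" where
  "exp_flat k s = (if s \<le> 0 then 0 else exp (- (1 / s)) / s ^ k)"

text \<open>This is the difference quotient of \<open>exp_flat k\<close> at the origin. From the
  right, the substitution x = 1/s turns it into \<open>x ^ Suc k / exp x\<close>, where the
  exponential wins.\<close>

lemma exp_flat_quotient_tendsto_0: "((\<lambda>s. exp_flat k s / s) \<longlongrightarrow> 0) (at 0)"
proof -
  have "((\<lambda>s. exp_flat k s / s) \<longlongrightarrow> 0) (at_left 0)"
    by (rule tendsto_eventually) (auto simp: exp_flat_def eventually_at_left_field intro!: exI[of _ "-1"])
  moreover have "((\<lambda>s. exp_flat k s / s) \<longlongrightarrow> 0) (at_right 0)"
  proof -
    have "((\<lambda>x::real. x ^ Suc k / exp x) \<longlongrightarrow> 0) at_top"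
      by (rule tendsto_power_div_exp_0)
    then have "((\<lambda>s::real. inverse s ^ Suc k / exp (inverse s)) \<longlongrightarrow> 0) (at_right 0)"
      by (rule filterlim_compose[OF _ filterlim_inverse_at_top_right])
    then show ?thesis
      by (rule Lim_transform_eventually)
        (auto simp: eventually_at_right_field exp_flat_def field_simps exp_minus intro!: exI[of _ 1])
  qed
  ultimately show ?thesis
    by (simp add: filterlim_split_at)
qed

text \<open>The parameter \<open>k\<close> exists for this formula: differentiating exp(-1/s)
  produces powers of 1/s, and the family indexed by \<open>k\<close> absorbs them. At 0 both terms
  on the right vanish.\<close>

lemma exp_flat_deriv:
  "(exp_flat k has_field_derivative exp_flat (k + 2) s - real k * exp_flat (k + 1) s) (at s)"
proof (cases s "0::real" rule: linorder_cases)
  case less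
  have "((\<lambda>_. 0) has_field_derivative 0) (at s)" by simp
  then have "(exp_flat k has_field_derivative 0) (at s)"
    by (rule has_field_derivative_transform_within_open[of _ _ _ "{..<0}"])
       (use less in \<open>auto simp: exp_flat_def\<close>)
  then show ?thesis using less by (simp add: exp_flat_def)
next
  case equal
  then show ?thesis
    using exp_flat_quotient_tendsto_0[of k] by (simp add: has_field_derivative_iff exp_flat_def)
next
  case greater
  have "((\<lambda>s. exp (- (1 / s)) * inverse (s ^ k)) has_field_derivative
      exp (- (1 / s)) * (1 / (s * s)) * inverse (s ^ k) +
      - (inverse (s ^ k) * (real k * s ^ (k - 1)) * inverse (s ^ k)) * exp (- (1 / s))) (at s)"
    by (rule derivative_eq_intros refl | use greater in \<open>simp add: field_simps\<close>)+
  also have "exp (- (1 / s)) * (1 / (s * s)) * inverse (s ^ k) +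
      - (inverse (s ^ k) * (real k * s ^ (k - 1)) * inverse (s ^ k)) * exp (- (1 / s))
      = exp_flat (k + 2) s - real k * exp_flat (k + 1) s"
    using greater by (cases k) (auto simp: exp_flat_def field_simps)
  finally show ?thesis
    by (rule has_field_derivative_transform_within_open[of _ _ _ "{0<..}"])
       (use greater in \<open>auto simp: exp_flat_def field_simps\<close>)
qed

text \<open>An algebra of functions closed under differentiation, hence consisting of smooth functions.\<close>

inductive_set bump_algebra :: "(real \<Rightarrow> real) set" where
  const: "(\<lambda>x. c) \<in> bump_algebra"
| flat: "(\<lambda>x. exp_flat k (c * x + d)) \<in> bump_algebra"
| add: "f \<in> bump_algebra \<Longrightarrow> g \<in> bump_algebra \<Longrightarrow> (\<lambda>x. f x + g x) \<in> bump_algebra"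
| mult: "f \<in> bump_algebra \<Longrightarrow> g \<in> bump_algebra \<Longrightarrow> (\<lambda>x. f x * g x) \<in> bump_algebra"

lemma bump_algebra_deriv:
  assumes "f \<in> bump_algebra"
  shows "\<exists>f'\<in>bump_algebra. \<forall>x. (f has_field_derivative f' x) (at x)"
  using assms
proof induction
  case (const c)
  then show ?case by (intro bexI[of _ "\<lambda>x. 0"]) (auto intro: bump_algebra.const)
next
  case (flat k c d)
  let ?f' = "\<lambda>x. (exp_flat (k + 2) (c * x + d) + (- real k) * exp_flat (k + 1) (c * x + d)) * c"
  have "?f' \<in> bump_algebra"
    by (intro bump_algebra.intros)
  moreover have "((\<lambda>x. exp_flat k (c * x + d)) has_field_derivative ?f' x) (at x)" for x
  proof -
    have "((\<lambda>x. c * x + d) has_field_derivative c) (at x)"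
      by (auto intro!: derivative_eq_intros)
    from DERIV_chain2[where f = "exp_flat k", OF exp_flat_deriv this] show ?thesis by simp
  qed
  ultimately show ?case by (intro bexI[of _ ?f'] allI)
next
  case (add f g)
  then obtain f' g' where "f' \<in> bump_algebra" "g' \<in> bump_algebra"
    "\<And>x. (f has_field_derivative f' x) (at x)" "\<And>x. (g has_field_derivative g' x) (at x)" by blast
  then show ?case
    by (intro bexI[of _ "\<lambda>x. f' x + g' x"]) (auto intro!: bump_algebra.intros derivative_intros)
next
  case (mult f g)
  then obtain f' g' where "f' \<in> bump_algebra" "g' \<in> bump_algebra"
    "\<And>x. (f has_field_derivative f' x) (at x)" "\<And>x. (g has_field_derivative g' x) (at x)" by blast
  then show ?case using mult
    by (intro bexI[of _ "\<lambda>x. f' x * g x + g' x * f x"])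
       (auto intro!: bump_algebra.intros derivative_intros DERIV_mult)
qed

lemma bump_algebra_higher_deriv: "f \<in> bump_algebra \<Longrightarrow> (deriv ^^ n) f \<in> bump_algebra"
proof (induction n)
  case (Suc n)
  then obtain f' where "f' \<in> bump_algebra"
    and "\<And>x. ((deriv ^^ n) f has_field_derivative f' x) (at x)"
    using bump_algebra_deriv by blast
  moreover from this have "deriv ((deriv ^^ n) f) = f'"
    by (auto intro: DERIV_imp_deriv)
  ultimately show ?case by simp
qed simp

lemma bump_algebra_differentiable:
  "f \<in> bump_algebra \<Longrightarrow> (deriv ^^ n) f field_differentiable at x"
  using bump_algebra_deriv[OF bump_algebra_higher_deriv] field_differentiable_def by blast

lemma bump_algebra_minus: "f \<in> bump_algebra \<Longrightarrow> (\<lambda>x. - f x) \<in> bump_algebra"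
  using bump_algebra.mult[OF bump_algebra.const[of "-1"], of f] by simp

lemma bump_algebra_diff:
  "f \<in> bump_algebra \<Longrightarrow> g \<in> bump_algebra \<Longrightarrow> (\<lambda>x. f x - g x) \<in> bump_algebra"
  using bump_algebra.add[OF _ bump_algebra_minus] by fastforce

lemma bump_algebra_power: "f \<in> bump_algebra \<Longrightarrow> (\<lambda>x. f x ^ n) \<in> bump_algebra"
  by (induction n) (auto intro: bump_algebra.intros)

lemma bump_algebra_prod:
  "finite I \<Longrightarrow> (\<And>i. i \<in> I \<Longrightarrow> f i \<in> bump_algebra) \<Longrightarrow> (\<lambda>x. \<Prod>i\<in>I. f i x) \<in> bump_algebra"
  by (induction I rule: finite_induct) (auto intro: bump_algebra.intros)

text \<open>The endpoints form one pair so that rational intervals can be enumerated. For reversed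
  endpoints the function is identically 0, which makes such pairs harmless.\<close>

definition bump :: "real \<times> real \<Rightarrow> real \<Rightarrow> real" where
  "bump ab x = exp_flat 0 (x - fst ab) * exp_flat 0 (snd ab - x)"

lemma bump_in_bump_algebra: "bump ab \<in> bump_algebra"
  unfolding bump_def
  using bump_algebra.mult[OF bump_algebra.flat[of 0 1 "- fst ab"] bump_algebra.flat[of 0 "-1" "snd ab"]]
  by (simp add: algebra_simps)

lemma exp_flat_0_bounds: "0 \<le> exp_flat 0 s" "exp_flat 0 s < 1" "0 < exp_flat 0 s \<longleftrightarrow> 0 < s"
  by (auto simp: exp_flat_def)

lemma bump_bounds: "0 \<le> bump ab x" "bump ab x < 1"
  unfolding bump_def using exp_flat_0_bounds[of "x - fst ab"] exp_flat_0_bounds[of "snd ab - x"]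
  by (simp_all add: mult_le_one) (metis less_le_trans linorder_not_less mult_left_le mult.commute less_eq_real_def mult_less_cancel_right2)

lemma bump_pos_iff: "0 < bump ab x \<longleftrightarrow> fst ab < x \<and> x < snd ab"
  unfolding bump_def using exp_flat_0_bounds[of "x - fst ab"] exp_flat_0_bounds[of "snd ab - x"]
  by (auto simp: zero_less_mult_iff)

text \<open>Multiplying the complements \<open>1 - bump\<close> avoids the need for cutoff functions with a plateau.\<close>

lemma bump_exhaustion:
  fixes W :: "real set"
  assumes "open W"
  shows "\<exists>\<zeta>. (\<forall>n::nat. \<zeta> n \<in> bump_algebra \<and> compact (closure {x. \<zeta> n x \<noteq> 0}) \<and>
      closure {x. \<zeta> n x \<noteq> 0} \<subseteq> W \<and> (\<forall>x. 0 \<le> \<zeta> n x \<and> \<zeta> n x \<le> 1)) \<and>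
      (\<forall>x\<in>W. (\<lambda>n. \<zeta> n x) \<longlonglongrightarrow> 1)"
proof -
  define P where "P = {ab \<in> \<rat> \<times> \<rat>. {fst ab..snd ab} \<subseteq> W}"
  have "countable P"
    unfolding P_def by (rule countable_subset[of _ "\<rat> \<times> \<rat>"]) (auto intro: countable_rat)
  \<comment> \<open>The reversed pair describes the empty interval, so \<open>P\<close> is nonempty
    even for empty \<open>W\<close> and can be the range of a sequence.\<close>
  moreover have "(1, 0) \<in> P" by (simp add: P_def)
  ultimately obtain e :: "nat \<Rightarrow> real \<times> real" where e: "range e = P"
    by (metis empty_iff range_from_nat_into)
  \<comment> \<open>The index \<open>n\<close> does two things: the number of factors grows until it
    reaches an interval around a given point of \<open>W\<close>, and the exponent drives the
    corresponding factor, which lies in [0, 1), to 0.\<close>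
  define \<zeta> where "\<zeta> n x = 1 - (\<Prod>i<n. (1 - bump (e i) x) ^ n)" for n x
  have alg: "\<zeta> n \<in> bump_algebra" for n
    unfolding \<zeta>_def
    by (intro bump_algebra_diff bump_algebra.const bump_algebra_prod bump_algebra_power
        bump_in_bump_algebra) auto
  have f: "0 \<le> (1 - bump (e i) x) ^ n" "(1 - bump (e i) x) ^ n \<le> 1" for i n x
    using bump_bounds[of "e i" x] by (auto intro!: power_le_one)
  then have b: "0 \<le> (\<Prod>i<n. (1 - bump (e i) x) ^ n)" "(\<Prod>i<n. (1 - bump (e i) x) ^ n) \<le> 1" for n x
    by (auto intro!: prod_nonneg prod_le_1)
  have supp: "compact (closure {x. \<zeta> n x \<noteq> 0}) \<and> closure {x. \<zeta> n x \<noteq> 0} \<subseteq> W" for n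
  proof -
    define C where "C = (\<Union>i<n. {fst (e i)..snd (e i)})"
    have "{x. \<zeta> n x \<noteq> 0} \<subseteq> C"
    proof (rule subsetI, rule ccontr)
      fix x assume x: "x \<in> {x. \<zeta> n x \<noteq> 0}" "x \<notin> C"
      have "bump (e i) x = 0" if "i < n" for i
        using bump_pos_iff[of "e i" x] bump_bounds(1)[of "e i" x] x(2) that
        by (force simp: C_def)
      then have "\<zeta> n x = 0" by (simp add: \<zeta>_def)
      with x(1) show False by simp
    qed
    moreover have "compact C" unfolding C_def by auto
    moreover have "C \<subseteq> W" 
    proof -
      have "e i \<in> P" for i
        using e by blast
      then have "{fst (e i)..snd (e i)} \<subseteq> W" for i
        unfolding P_def by blast
      then show ?thesis unfolding C_def by (intro UN_least)
    qed
    ultimately show ?thesis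
      using closure_minimal[of "{x. \<zeta> n x \<noteq> 0}" C] compact_imp_closed[of C]
        bounded_subset[OF compact_imp_bounded[of C]]
      by (simp only: compact_closure) blast
  qed
  have lim: "(\<lambda>n. \<zeta> n x) \<longlonglongrightarrow> 1" if "x \<in> W" for x
  proof -
    obtain d where d: "d > 0" "cball x d \<subseteq> W"
      using assms \<open>x \<in> W\<close> open_contains_cball by blast
    obtain a b where ab: "a \<in> \<rat>" "b \<in> \<rat>" "x - d < a" "a < x" "x < b" "b < x + d"
      using Rats_dense_in_real[of "x - d" x] Rats_dense_in_real[of x "x + d"] d(1) by auto
    have "{a..b} \<subseteq> cball x d"
      using ab by (auto simp: dist_real_def)
    then have "(a, b) \<in> P" using ab d by (auto simp: P_def)
    then obtain i where i: "e i = (a, b)" using e by (metis imageE)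
    let ?q = "1 - bump (e i) x"
    have q: "0 \<le> ?q" "?q < 1"
      using bump_pos_iff[of "e i" x] bump_bounds(2)[of "e i" x] i ab by auto
    have "(\<Prod>j<n. (1 - bump (e j) x) ^ n) \<le> ?q ^ n" if "i < n" for n
    proof -
      have "(\<Prod>j<n. (1 - bump (e j) x) ^ n) = ?q ^ n * (\<Prod>j\<in>{..<n} - {i}. (1 - bump (e j) x) ^ n)"
        using that by (subst prod.remove[of _ i]) auto
      also have "\<dots> \<le> ?q ^ n * 1"
        using f q by (intro mult_left_mono prod_le_1) auto
      finally show ?thesis by simp
    qed
    then have "eventually (\<lambda>n. (\<Prod>j<n. (1 - bump (e j) x) ^ n) \<le> ?q ^ n) sequentially"
      using eventually_gt_at_top[of i] by (rule eventually_mono[rotated])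
    then have "(\<lambda>n. \<Prod>j<n. (1 - bump (e j) x) ^ n) \<longlonglongrightarrow> 0"
      by (rule tendsto_sandwich[OF always_eventually[OF allI[OF b(1)]] _ tendsto_const LIMSEQ_realpow_zero[OF q]])
    from tendsto_diff[OF tendsto_const[of 1] this] show ?thesis by (simp add: \<zeta>_def)
  qed
  from b have bd: "0 \<le> \<zeta> n x \<and> \<zeta> n x \<le> 1" for n x
    by (simp add: \<zeta>_def)
  show ?thesis
    by (intro exI[of _ \<zeta>] conjI allI ballI; (rule alg supp[THEN conjunct1] supp[THEN conjunct2]
          bd[THEN conjunct1] bd[THEN conjunct2] lim)?)
qed

section \<open>Weak derivatives of locally Lipschitz functions\<close>

lemma
  assumes "test_fun \<Omega> \<zeta>"
  shows test_fun_deriv: "(\<zeta> has_field_derivative deriv \<zeta> x) (at x)"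
    and test_fun_continuous: "continuous_on A \<zeta>"
    and test_fun_continuous_deriv: "continuous_on A (deriv \<zeta>)"
    and test_fun_support: "\<zeta> x \<noteq> 0 \<Longrightarrow> x \<in> \<Omega>"
    and test_fun_support_deriv: "deriv \<zeta> x \<noteq> 0 \<Longrightarrow> x \<in> \<Omega>"
    and test_fun_bounded_support: "\<exists>R>0. \<forall>x. R < \<bar>x\<bar> \<longrightarrow> \<zeta> x = 0 \<and> deriv \<zeta> x = 0"
proof -
  have d: "(deriv ^^ n) \<zeta> field_differentiable at x" for n x
    using assms by (simp add: test_fun_def)
  have c: "compact (closure {x. \<zeta> x \<noteq> 0})" and s: "closure {x. \<zeta> x \<noteq> 0} \<subseteq> \<Omega>"
    using assms by (simp_all add: test_fun_def)
  show "(\<zeta> has_field_derivative deriv \<zeta> x) (at x)" for x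
    using d[of 0 x] by (simp add: field_differentiable_derivI)
  then show "continuous_on A \<zeta>"
    by (meson DERIV_isCont continuous_at_imp_continuous_on)
  show "continuous_on A (deriv \<zeta>)"
    using d[of 1] by (auto intro: continuous_at_imp_continuous_on field_differentiable_imp_continuous_at)
  \<comment> \<open>Off the closed support \<open>\<zeta>\<close> vanishes on a whole neighbourhood,
    so its derivative vanishes there as well.\<close>
  have z: "\<zeta> x = 0 \<and> deriv \<zeta> x = 0" if "x \<notin> closure {x. \<zeta> x \<noteq> 0}" for x
  proof
    have "((\<lambda>x. 0) has_field_derivative 0) (at x)" by simp
    then have "(\<zeta> has_field_derivative 0) (at x)"
    proof (rule has_field_derivative_transform_within_open)
      show "open (- closure {x. \<zeta> x \<noteq> 0})" by (rule open_Compl) (rule closed_closure)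
      show "x \<in> - closure {x. \<zeta> x \<noteq> 0}" using that by simp
      show "0 = \<zeta> y" if "y \<in> - closure {x. \<zeta> x \<noteq> 0}" for y
        using that closure_subset[of "{x. \<zeta> x \<noteq> 0}"] by force
    qed
    then show "deriv \<zeta> x = 0" by (rule DERIV_imp_deriv)
    show "\<zeta> x = 0" using that closure_subset[of "{x. \<zeta> x \<noteq> 0}"] by force
  qed
  show "\<zeta> x \<noteq> 0 \<Longrightarrow> x \<in> \<Omega>" "deriv \<zeta> x \<noteq> 0 \<Longrightarrow> x \<in> \<Omega>" using z s by blast+
  obtain R where "R > 0" "\<And>x. x \<in> closure {x. \<zeta> x \<noteq> 0} \<Longrightarrow> norm x \<le> R"
    using compact_imp_bounded[OF c] bounded_pos by blast
  then show "\<exists>R>0. \<forall>x. R < \<bar>x\<bar> \<longrightarrow> \<zeta> x = 0 \<and> deriv \<zeta> x = 0"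
    using z by (intro exI[of _ R]) (metis linorder_not_less real_norm_def)
qed

section \<open>Locally bounded and locally Lipschitz functions\<close>

definition locally_bounded :: "(real \<Rightarrow> real) \<Rightarrow> bool" where
  "locally_bounded f \<longleftrightarrow> (\<forall>R. \<exists>B. \<forall>x. \<bar>x\<bar> \<le> R \<longrightarrow> \<bar>f x\<bar> \<le> B)"

lemma locally_boundedE:
  assumes "locally_bounded f"
  obtains B where "0 \<le> B" "\<And>x. \<bar>x\<bar> \<le> R \<Longrightarrow> \<bar>f x\<bar> \<le> B"
proof -
  obtain B where "\<And>x. \<bar>x\<bar> \<le> R \<Longrightarrow> \<bar>f x\<bar> \<le> B"
    using assms unfolding locally_bounded_def by blast
  then show ?thesis using that[of "max 0 B"] by (simp add: le_max_iff_disj)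
qed

definition locally_lipschitz :: "(real \<Rightarrow> real) \<Rightarrow> bool" where
  "locally_lipschitz f \<longleftrightarrow> (\<forall>R. \<exists>L. \<forall>x y. \<bar>x\<bar> \<le> R \<and> \<bar>y\<bar> \<le> R \<longrightarrow> \<bar>f x - f y\<bar> \<le> L * \<bar>x - y\<bar>)"

lemma locally_lipschitzE:
  assumes "locally_lipschitz f"
  obtains L where "0 \<le> L" "\<And>x y. \<bar>x\<bar> \<le> R \<Longrightarrow> \<bar>y\<bar> \<le> R \<Longrightarrow> \<bar>f x - f y\<bar> \<le> L * \<bar>x - y\<bar>"
proof -
  obtain L where L: "\<And>x y. \<bar>x\<bar> \<le> R \<Longrightarrow> \<bar>y\<bar> \<le> R \<Longrightarrow> \<bar>f x - f y\<bar> \<le> L * \<bar>x - y\<bar>"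
    using assms unfolding locally_lipschitz_def by blast
  have "\<bar>f x - f y\<bar> \<le> max 0 L * \<bar>x - y\<bar>" if "\<bar>x\<bar> \<le> R" "\<bar>y\<bar> \<le> R" for x y
    using L[OF that] by (smt (verit) abs_ge_zero mult_right_mono)
  then show ?thesis using that[of "max 0 L"] by simp
qed

lemma locally_lipschitz_continuous:
  assumes "locally_lipschitz f"
  shows "continuous_on UNIV f"
proof (rule continuous_at_imp_continuous_on, rule ballI)
  fix x
  obtain L where L: "0 \<le> L" "\<And>y z. \<bar>y\<bar> \<le> \<bar>x\<bar> + 1 \<Longrightarrow> \<bar>z\<bar> \<le> \<bar>x\<bar> + 1 \<Longrightarrow> \<bar>f y - f z\<bar> \<le> L * \<bar>y - z\<bar>"
    using locally_lipschitzE[OF assms, of "\<bar>x\<bar> + 1"] by blast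
  have "eventually (\<lambda>y. norm (f y - f x) \<le> L * \<bar>y - x\<bar>) (at x)"
    unfolding eventually_at using L(2) by (intro exI[of _ 1]) (auto simp: dist_real_def)
  moreover have "((\<lambda>y. L * \<bar>y - x\<bar>) \<longlongrightarrow> L * \<bar>x - x\<bar>) (at x)"
    by (intro tendsto_intros)
  then have "((\<lambda>y. L * \<bar>y - x\<bar>) \<longlongrightarrow> 0) (at x)" by simp
  ultimately have "((\<lambda>y. f y - f x) \<longlongrightarrow> 0) (at x)"
    by (rule Lim_null_comparison)
  then show "isCont f x"
    by (simp add: isCont_def LIM_zero_iff)
qed

lemma locally_lipschitz_bounded:
  assumes "locally_lipschitz f"
  shows "locally_bounded f"
  unfolding locally_bounded_def
proof
  fix R
  have "compact (f ` {-R..R})"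
    by (intro compact_continuous_image continuous_on_subset[OF locally_lipschitz_continuous[OF assms]]) auto
  then obtain B where "\<forall>y\<in>f ` {-R..R}. norm y \<le> B"
    using compact_imp_bounded bounded_iff by blast
  then have "\<bar>f x\<bar> \<le> B" if "\<bar>x\<bar> \<le> R" for x
    using that by (metis abs_le_iff atLeastAtMost_iff imageI minus_le_iff real_norm_def)
  then show "\<exists>B. \<forall>x. \<bar>x\<bar> \<le> R \<longrightarrow> \<bar>f x\<bar> \<le> B"
    by blast
qed

text \<open>Integration by parts without Fubini or absolute continuity: shift the difference quotient of \<open>f\<close>
  onto \<open>\<zeta>\<close> by translation invariance and let the step tend to \<open>0\<close>.\<close>

lemma locally_lipschitz_by_parts:
  assumes f: "locally_lipschitz f"
    and g: "g \<in> borel_measurable borel"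
    and fg: "AE x in lborel. (f has_field_derivative g x) (at x)"
    and \<zeta>: "test_fun \<Omega> \<zeta>"
  shows "(\<integral>x. f x * deriv \<zeta> x \<partial>lborel) = - (\<integral>x. g x * \<zeta> x \<partial>lborel)"
proof -
  obtain R where R: "R > 0" "\<And>x. R < \<bar>x\<bar> \<Longrightarrow> \<zeta> x = 0" "\<And>x. R < \<bar>x\<bar> \<Longrightarrow> deriv \<zeta> x = 0"
    using test_fun_bounded_support[OF \<zeta>] by blast
  have dz: "(\<zeta> has_field_derivative deriv \<zeta> x) (at x)" for x
    by (rule test_fun_deriv[OF \<zeta>])
  obtain M where M: "0 \<le> M" "\<And>x. \<bar>\<zeta> x\<bar> \<le> M" "\<And>x. \<bar>deriv \<zeta> x\<bar> \<le> M"
  proof -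
    have "compact (\<zeta> ` {-R..R})" "compact (deriv \<zeta> ` {-R..R})"
      by (auto intro!: compact_continuous_image test_fun_continuous[OF \<zeta>] test_fun_continuous_deriv[OF \<zeta>])
    then obtain A B where AB: "\<forall>y\<in>\<zeta> ` {-R..R}. norm y \<le> A" "\<forall>y\<in>deriv \<zeta> ` {-R..R}. norm y \<le> B"
      using compact_imp_bounded bounded_iff by meson
    have "\<bar>\<zeta> x\<bar> \<le> max 0 (max A B) \<and> \<bar>deriv \<zeta> x\<bar> \<le> max 0 (max A B)" for x
    proof (cases "R < \<bar>x\<bar>")
      case False
      then have "x \<in> {-R..R}" unfolding atLeastAtMost_iff by linarith
      then have "\<bar>\<zeta> x\<bar> \<le> A" "\<bar>deriv \<zeta> x\<bar> \<le> B" using AB by auto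
      then show ?thesis by (auto simp: le_max_iff_disj)
    qed (simp add: R)
    then show ?thesis by (intro that[of "max 0 (max A B)"]) auto
  qed
  have lip: "\<bar>\<zeta> x - \<zeta> y\<bar> \<le> M * \<bar>x - y\<bar>" for x y
    using field_differentiable_bound[of UNIV \<zeta> "deriv \<zeta>" M x y] dz M(3)
    by (auto intro: has_field_derivative_at_within)
  \<comment> \<open>The steps \<open>h n\<close> are at most 1, so every translate met below keeps
    its support in the interval of radius \<open>R + 1\<close>; bounds on that interval
    suffice.\<close>
  obtain L where L: "0 \<le> L" "\<And>x y. \<bar>x\<bar> \<le> R + 1 \<Longrightarrow> \<bar>y\<bar> \<le> R + 1 \<Longrightarrow> \<bar>f x - f y\<bar> \<le> L * \<bar>x - y\<bar>"
    using locally_lipschitzE[OF f, of "R + 1"] by blast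
  obtain B where B: "0 \<le> B" "\<And>x. \<bar>x\<bar> \<le> R + 1 \<Longrightarrow> \<bar>f x\<bar> \<le> B"
    using locally_boundedE[OF locally_lipschitz_bounded[OF f], of "R + 1"] by blast
  have [measurable]: "f \<in> borel_measurable borel" "\<zeta> \<in> borel_measurable borel" "deriv \<zeta> \<in> borel_measurable borel"
    using locally_lipschitz_continuous[OF f] test_fun_continuous[OF \<zeta>, of UNIV]
      test_fun_continuous_deriv[OF \<zeta>, of UNIV]
    by (auto intro: borel_measurable_continuous_onI)
  note g[measurable]
  define h where "h n = 1 / real (Suc n)" for n
  have h: "0 < h n" "h n \<le> 1" for n by (auto simp: h_def)
  have h0: "h \<longlonglongrightarrow> 0" unfolding h_def by (rule LIMSEQ_Suc) (rule lim_1_over_n)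
  have hat: "filterlim h (at 0) sequentially"
    using h0 h(1) by (auto simp: filterlim_at intro!: eventuallyI less_imp_neq[THEN not_sym])
  have hat': "filterlim (\<lambda>n. - h n) (at 0) sequentially"
    using tendsto_minus[OF h0] h(1) by (auto simp: filterlim_at intro!: eventuallyI less_imp_neq[THEN not_sym])
  \<comment> \<open>\<open>A\<close> is the forward quotient of \<open>f\<close> tested against
    \<open>\<zeta>\<close>. Translation turns its integral into minus that of \<open>C\<close>,
    which carries the backward quotient of \<open>\<zeta>\<close>. The constants
    \<open>L * M\<close> and \<open>B * M\<close> dominate them on the enlarged interval.\<close>
  define A where "A n x = (f (x + h n) - f x) / h n * \<zeta> x" for n x
  define C where "C n x = f x * ((\<zeta> x - \<zeta> (x - h n)) / h n)" for n x
  have int: "integrable lborel (\<lambda>x. indicator {-(R + 1)..R + 1} x * c)" for c :: real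
    by (rule integrable_mult_left, rule integrable_real_indicator) (auto simp: emeasure_lborel_Icc_eq)
  have bdI: "integrable lborel u"
    if "u \<in> borel_measurable borel" "\<And>x. \<bar>u x\<bar> \<le> indicator {-(R + 1)..R + 1} x * c" for u and c :: real
    by (rule Bochner_Integration.integrable_bound[OF int[of c]]) (use that in \<open>auto intro: order_trans abs_ge_self\<close>)
  have fz: "\<bar>f (x + s) * \<zeta> x\<bar> \<le> indicator {-(R + 1)..R + 1} x * (B * M)" if "\<bar>s\<bar> \<le> 1" for x s
  proof (cases "R < \<bar>x\<bar>")
    case False
    then have "\<bar>f (x + s)\<bar> \<le> B" using that by (intro B) auto
    then show ?thesis using False M by (auto simp: abs_mult indicator_def intro!: mult_mono B)
  qed (use R M B in auto)
  have i1: "integrable lborel (\<lambda>x. f (x + s) * \<zeta> x)" if "\<bar>s\<bar> \<le> 1" for s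
    by (rule bdI[OF _ fz[OF that]]) simp
  have shift: "(\<integral>x. f (x + s) * \<zeta> x \<partial>lborel) = (\<integral>x. f x * \<zeta> (x - s) \<partial>lborel)"
    and shift_int: "\<bar>s\<bar> \<le> 1 \<Longrightarrow> integrable lborel (\<lambda>x. f x * \<zeta> (x - s))" for s
    using lborel_integral_real_affine[of 1 "\<lambda>x. f x * \<zeta> (x - s)" s]
      lborel_integrable_real_affine_iff[of 1 "\<lambda>x. f x * \<zeta> (x - s)" s] i1[of s]
    by (auto simp: add.commute)
  have eq: "(\<integral>x. A n x \<partial>lborel) = - (\<integral>x. C n x \<partial>lborel)" for n
  proof -
    have "(\<integral>x. A n x \<partial>lborel) = (\<integral>x. (f (x + h n) * \<zeta> x - f (x + 0) * \<zeta> x) / h n \<partial>lborel)"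
      by (simp add: A_def left_diff_distrib)
    also have "\<dots> = ((\<integral>x. f (x + h n) * \<zeta> x \<partial>lborel) - (\<integral>x. f (x + 0) * \<zeta> x \<partial>lborel)) / h n"
      using h[of n] by (simp only: integral_divide_zero, subst Bochner_Integration.integral_diff)
        (auto intro!: i1 simp: i1[of 0, simplified])
    also have "\<dots> = ((\<integral>x. f x * \<zeta> (x - h n) \<partial>lborel) - (\<integral>x. f x * \<zeta> (x - 0) \<partial>lborel)) / h n"
      by (simp only: shift)
    also have "\<dots> = (\<integral>x. (f x * \<zeta> (x - h n) - f x * \<zeta> (x - 0)) / h n \<partial>lborel)"
      using h[of n] by (simp only: integral_divide_zero, subst Bochner_Integration.integral_diff)
        (auto intro!: shift_int simp: shift_int[of 0, simplified])
    also have "\<dots> = - (\<integral>x. C n x \<partial>lborel)"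
      by (subst integral_minus[symmetric], rule Bochner_Integration.integral_cong)
        (simp_all add: C_def minus_divide_left algebra_simps)
    finally show ?thesis .
  qed
  have limA: "(\<lambda>n. \<integral>x. A n x \<partial>lborel) \<longlonglongrightarrow> (\<integral>x. g x * \<zeta> x \<partial>lborel)"
  proof (rule integral_dominated_convergence[where w = "\<lambda>x. indicator {-(R + 1)..R + 1} x * (L * M)"])
    show "AE x in lborel. (\<lambda>n. A n x) \<longlonglongrightarrow> g x * \<zeta> x"
      using fg
    proof eventually_elim
      case (elim x)
      then have "((\<lambda>s. (f (x + s) - f x) / s) \<longlongrightarrow> g x) (at 0)" by (simp add: DERIV_def)
      from filterlim_compose[OF this hat] show ?case
        unfolding A_def by (intro tendsto_intros)
    qed
    show "AE x in lborel. norm (A n x) \<le> indicator {-(R + 1)..R + 1} x * (L * M)" for n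
    proof (rule AE_I2)
      fix x
      show "norm (A n x) \<le> indicator {-(R + 1)..R + 1} x * (L * M)"
      proof (cases "R < \<bar>x\<bar>")
        case False
        then have "\<bar>f (x + h n) - f x\<bar> \<le> L * h n"
          using L(2)[of "x + h n" x] h[of n] by auto
        then have "\<bar>f (x + h n) - f x\<bar> / h n \<le> L"
          using h[of n] by (simp add: pos_divide_le_eq)
        then have "\<bar>f (x + h n) - f x\<bar> / h n * \<bar>\<zeta> x\<bar> \<le> L * M"
          using M L h[of n] by (intro mult_mono) auto
        then show ?thesis using False h[of n] by (auto simp: A_def abs_mult indicator_def)
      qed (use R M L in \<open>auto simp: A_def\<close>)
    qed
    show "integrable lborel (\<lambda>x. indicator {-(R + 1)..R + 1} x * (L * M))"
      by (rule int)
  qed (simp_all add: A_def[abs_def])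
  have limC: "(\<lambda>n. \<integral>x. C n x \<partial>lborel) \<longlonglongrightarrow> (\<integral>x. f x * deriv \<zeta> x \<partial>lborel)"
  proof (rule integral_dominated_convergence[where w = "\<lambda>x. indicator {-(R + 1)..R + 1} x * (B * M)"])
    show "AE x in lborel. (\<lambda>n. C n x) \<longlonglongrightarrow> f x * deriv \<zeta> x"
    proof (rule AE_I2)
      fix x
      have "((\<lambda>s. (\<zeta> (x + s) - \<zeta> x) / s) \<longlongrightarrow> deriv \<zeta> x) (at 0)"
        using dz[of x] by (simp add: DERIV_def)
      from filterlim_compose[OF this hat'] have "(\<lambda>n. (\<zeta> x - \<zeta> (x - h n)) / h n) \<longlonglongrightarrow> deriv \<zeta> x"
        by (simp add: minus_divide_left[symmetric] minus_divide_right[symmetric] diff_divide_distrib)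
      then show "(\<lambda>n. C n x) \<longlonglongrightarrow> f x * deriv \<zeta> x"
        unfolding C_def by (intro tendsto_intros)
    qed
    show "AE x in lborel. norm (C n x) \<le> indicator {-(R + 1)..R + 1} x * (B * M)" for n
    proof (rule AE_I2)
      fix x
      show "norm (C n x) \<le> indicator {-(R + 1)..R + 1} x * (B * M)"
      proof (cases "R + 1 < \<bar>x\<bar>")
        case True
        then have "\<zeta> x = 0" "\<zeta> (x - h n) = 0" using h[of n] by (auto intro!: R(2))
        then show ?thesis using M B by (simp add: C_def)
      next
        case False
        have "\<bar>\<zeta> x - \<zeta> (x - h n)\<bar> \<le> M * h n" using lip[of x "x - h n"] h[of n] by simp
        then have "\<bar>\<zeta> x - \<zeta> (x - h n)\<bar> / h n \<le> M"
          using h[of n] by (simp add: pos_divide_le_eq)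
        then have "\<bar>f x\<bar> * (\<bar>\<zeta> x - \<zeta> (x - h n)\<bar> / h n) \<le> B * M"
          using M B False h[of n] by (intro mult_mono) auto
        then show ?thesis using False h[of n] by (auto simp: C_def abs_mult indicator_def)
      qed
    qed
    show "integrable lborel (\<lambda>x. indicator {-(R + 1)..R + 1} x * (B * M))"
      by (rule int)
  qed (simp_all add: C_def[abs_def])
  have "(\<integral>x. g x * \<zeta> x \<partial>lborel) = - (\<integral>x. f x * deriv \<zeta> x \<partial>lborel)"
    using LIMSEQ_unique[OF limA[unfolded eq] tendsto_minus[OF limC]] .
  then show ?thesis by simp
qed

section \<open>Locally bounded Borel functions in the function spaces\<close>

lemma set_integrable_bounded_set:
  fixes f :: "real \<Rightarrow> real"
  assumes [measurable]: "f \<in> borel_measurable borel" "V \<in> sets borel" and "locally_bounded f" "bounded V"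
  shows "set_integrable lborel V f" "set_integrable lebesgue V f"
proof -
  obtain R where R: "\<And>x. x \<in> V \<Longrightarrow> \<bar>x\<bar> \<le> R"
    using \<open>bounded V\<close> by (auto simp: bounded_iff)
  obtain B where B: "0 \<le> B" "\<And>x. \<bar>x\<bar> \<le> R \<Longrightarrow> \<bar>f x\<bar> \<le> B"
    using locally_boundedE[OF \<open>locally_bounded f\<close>] by blast
  have "integrable lborel (\<lambda>x. indicator {-R..R} x * B)"
    by (rule integrable_mult_left, rule integrable_real_indicator) (auto simp: emeasure_lborel_Icc_eq)
  then have *: "integrable lborel (\<lambda>x. indicator V x *\<^sub>R f x)"
  proof (rule Bochner_Integration.integrable_bound)
    show "AE x in lborel. norm (indicator V x *\<^sub>R f x) \<le> norm (indicator {-R..R} x * B)"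
    proof (rule AE_I2)
      fix x show "norm (indicator V x *\<^sub>R f x) \<le> norm (indicator {-R..R} x * B)"
        using R[of x] B(2)[of x] B(1) by (auto simp: indicator_def)
    qed
  qed simp
  then show "set_integrable lborel V f" by (simp add: set_integrable_def)
  show "set_integrable lebesgue V f"
    unfolding set_integrable_def by (subst integrable_completion) (use * in auto)
qed

lemma Linf_bounded_set:
  assumes [measurable]: "f \<in> borel_measurable borel" "V \<in> sets borel" and "locally_bounded f" "bounded V"
  shows "Linf V f"
proof -
  obtain R where R: "\<And>x. x \<in> V \<Longrightarrow> \<bar>x\<bar> \<le> R"
    using \<open>bounded V\<close> by (auto simp: bounded_iff)
  obtain B where B: "0 \<le> B" "\<And>x. \<bar>x\<bar> \<le> R \<Longrightarrow> \<bar>f x\<bar> \<le> B"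
    using locally_boundedE[OF \<open>locally_bounded f\<close>] by blast
  have "(\<lambda>x. indicator V x *\<^sub>R f x) \<in> borel_measurable borel"
    by measurable
  then have "set_borel_measurable lebesgue V f"
    unfolding set_borel_measurable_def by (intro measurable_completion) simp
  then show ?thesis
    unfolding Linf_def using B R by (auto intro!: exI[of _ B] AE_I2)
qed

lemma compactly_insideD:
  assumes "compactly_inside V \<Omega>"
  shows "V \<in> sets borel" "bounded V"
  using assms unfolding compactly_inside_def
  by (auto intro: borel_open bounded_subset[OF compact_imp_bounded] closure_subset)

lemma Linf_loc_locally_bounded:
  "f \<in> borel_measurable borel \<Longrightarrow> locally_bounded f \<Longrightarrow> Linf_loc \<Omega> f"
  by (simp add: Linf_loc_def Linf_bounded_set compactly_insideD)

lemma L1_loc_locally_bounded: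
  "f \<in> borel_measurable borel \<Longrightarrow> locally_bounded f \<Longrightarrow> L1_loc \<Omega> f"
  by (simp add: L1_loc_def set_integrable_bounded_set compactly_insideD)

text \<open>\<open>g\<close> is a fixed Borel representative of the derivative, bounded at every
  point of a compact interval and not merely almost everywhere. Products with test functions are
  then integrable at once, and the relation is stable under sums.\<close>

definition lipschitz_primitive :: "(real \<Rightarrow> real) \<Rightarrow> (real \<Rightarrow> real) \<Rightarrow> bool" where
  "lipschitz_primitive f g \<longleftrightarrow> locally_lipschitz f \<and> g \<in> borel_measurable borel \<and> locally_bounded g \<and>
     (AE x in lborel. (f has_field_derivative g x) (at x))"

lemma lipschitz_primitiveD:
  assumes "lipschitz_primitive f g"
  shows "f \<in> borel_measurable borel" "locally_bounded f" "g \<in> borel_measurable borel" "locally_bounded g"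
  using assms locally_lipschitz_bounded[of f] locally_lipschitz_continuous[of f]
  by (auto simp: lipschitz_primitive_def intro: borel_measurable_continuous_onI)

lemma locally_bounded_add:
  assumes "locally_bounded f" "locally_bounded g"
  shows "locally_bounded (\<lambda>x. f x + g x)"
  unfolding locally_bounded_def
proof
  fix R
  obtain A where A: "\<And>x. \<bar>x\<bar> \<le> R \<Longrightarrow> \<bar>f x\<bar> \<le> A" using locally_boundedE[OF assms(1)] by blast
  obtain B where B: "\<And>x. \<bar>x\<bar> \<le> R \<Longrightarrow> \<bar>g x\<bar> \<le> B" using locally_boundedE[OF assms(2)] by blast
  have "\<bar>f x + g x\<bar> \<le> A + B" if "\<bar>x\<bar> \<le> R" for x
    using A[OF that] B[OF that] by linarith
  then show "\<exists>B. \<forall>x. \<bar>x\<bar> \<le> R \<longrightarrow> \<bar>f x + g x\<bar> \<le> B" by blast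
qed

lemma locally_lipschitz_add:
  assumes "locally_lipschitz f" "locally_lipschitz g"
  shows "locally_lipschitz (\<lambda>x. f x + g x)"
  unfolding locally_lipschitz_def
proof
  fix R
  obtain A where A: "\<And>x y. \<bar>x\<bar> \<le> R \<Longrightarrow> \<bar>y\<bar> \<le> R \<Longrightarrow> \<bar>f x - f y\<bar> \<le> A * \<bar>x - y\<bar>"
    using locally_lipschitzE[OF assms(1)] by blast
  obtain B where B: "\<And>x y. \<bar>x\<bar> \<le> R \<Longrightarrow> \<bar>y\<bar> \<le> R \<Longrightarrow> \<bar>g x - g y\<bar> \<le> B * \<bar>x - y\<bar>"
    using locally_lipschitzE[OF assms(2)] by blast
  have "\<bar>f x + g x - (f y + g y)\<bar> \<le> (A + B) * \<bar>x - y\<bar>" if "\<bar>x\<bar> \<le> R" "\<bar>y\<bar> \<le> R" for x y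
    using A[OF that] B[OF that] unfolding distrib_right by linarith
  then show "\<exists>L. \<forall>x y. \<bar>x\<bar> \<le> R \<and> \<bar>y\<bar> \<le> R \<longrightarrow> \<bar>f x + g x - (f y + g y)\<bar> \<le> L * \<bar>x - y\<bar>" by blast
qed

lemma lipschitz_primitive_add:
  assumes "lipschitz_primitive f f'" "lipschitz_primitive g g'"
  shows "lipschitz_primitive (\<lambda>x. f x + g x) (\<lambda>x. f' x + g' x)"
proof -
  have "AE x in lborel. (f has_field_derivative f' x) (at x)"
    "AE x in lborel. (g has_field_derivative g' x) (at x)"
    using assms by (auto simp: lipschitz_primitive_def)
  then have "AE x in lborel. ((\<lambda>x. f x + g x) has_field_derivative f' x + g' x) (at x)"
    by eventually_elim (rule DERIV_add)
  then show ?thesis using assms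
    by (auto simp: lipschitz_primitive_def intro!: locally_bounded_add locally_lipschitz_add)
qed

text \<open>The left integral is over \<open>lebesgue\<close>, as in the definitions of variation,
  weak derivative and pairing; the right one is over \<open>lborel\<close>, where the densities are
  compared.\<close>

lemma lipschitz_primitive_by_parts:
  assumes "lipschitz_primitive f g" and \<zeta>: "test_fun \<Omega> \<zeta>"
  shows "(\<integral>x. f x * deriv \<zeta> x \<partial>lebesgue) = - (\<integral>x. g x * \<zeta> x \<partial>lborel)"
proof -
  have [measurable]: "f \<in> borel_measurable borel" "deriv \<zeta> \<in> borel_measurable borel"
    using lipschitz_primitiveD[OF assms(1)] test_fun_continuous_deriv[OF \<zeta>, of UNIV]
    by (auto intro: borel_measurable_continuous_onI)
  show ?thesis
    by (subst integral_completion)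
      (use assms(1) in \<open>auto simp: lipschitz_primitive_def intro!: locally_lipschitz_by_parts[OF _ _ _ \<zeta>]\<close>)
qed

text \<open>Only values in \<Omega> enter a weak derivative on \<Omega>. This carries results about
  reflected functions on the line back to profiles on the half-line.\<close>

lemma weak_deriv_cong:
  assumes "weak_deriv \<Omega> f g" "\<And>x. x \<in> \<Omega> \<Longrightarrow> f x = f' x" "\<And>x. x \<in> \<Omega> \<Longrightarrow> g x = g' x"
  shows "weak_deriv \<Omega> f' g'"
proof -
  have sub: "V \<subseteq> \<Omega>" if "compactly_inside V \<Omega>" for V
    using that closure_subset unfolding compactly_inside_def by blast
  have "(\<lambda>x. indicator V x *\<^sub>R f x) = (\<lambda>x. indicator V x *\<^sub>R f' x)"
    "(\<lambda>x. indicator V x *\<^sub>R g x) = (\<lambda>x. indicator V x *\<^sub>R g' x)"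
    if "compactly_inside V \<Omega>" for V
    using sub[OF that] assms(2,3) by (auto simp: indicator_def fun_eq_iff)
  then have "L1_loc \<Omega> f'" "L1_loc \<Omega> g'"
    using assms(1) unfolding weak_deriv_def L1_loc_def set_integrable_def by metis+
  moreover have "(LINT x:\<Omega>|lebesgue. f x * deriv \<zeta> x) = (LINT x:\<Omega>|lebesgue. f' x * deriv \<zeta> x)"
    "(LINT x:\<Omega>|lebesgue. g x * \<zeta> x) = (LINT x:\<Omega>|lebesgue. g' x * \<zeta> x)" for \<zeta>
    unfolding set_lebesgue_integral_def
    by (auto intro!: Bochner_Integration.integral_cong simp: assms(2,3) indicator_def)
  ultimately show ?thesis using assms(1) by (simp add: weak_deriv_def)
qed

text \<open>Test functions for \<Omega> and their derivatives vanish off \<Omega>, so the set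
  integrals are integrals over the line, whatever \<Omega> is.\<close>

lemma lipschitz_primitive_weak_deriv:
  assumes fg: "lipschitz_primitive f g"
  shows "weak_deriv \<Omega> f g"
  unfolding weak_deriv_def
proof (intro conjI allI impI)
  show "L1_loc \<Omega> f" "L1_loc \<Omega> g"
    using lipschitz_primitiveD[OF fg] by (auto intro: L1_loc_locally_bounded)
  fix \<zeta> assume \<zeta>: "test_fun \<Omega> \<zeta>"
  have [measurable]: "\<zeta> \<in> borel_measurable borel" "g \<in> borel_measurable borel"
    using lipschitz_primitiveD[OF fg] test_fun_continuous[OF \<zeta>, of UNIV]
    by (auto intro: borel_measurable_continuous_onI)
  have "(LINT x:\<Omega>|lebesgue. f x * deriv \<zeta> x) = (\<integral>x. f x * deriv \<zeta> x \<partial>lebesgue)"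
    "(LINT x:\<Omega>|lebesgue. g x * \<zeta> x) = (\<integral>x. g x * \<zeta> x \<partial>lebesgue)"
    unfolding set_lebesgue_integral_def
    using test_fun_support[OF \<zeta>] test_fun_support_deriv[OF \<zeta>]
    by (intro Bochner_Integration.integral_cong; fastforce simp: indicator_def)+
  then show "(LINT x:\<Omega>|lebesgue. f x * deriv \<zeta> x) = - (LINT x:\<Omega>|lebesgue. g x * \<zeta> x)"
    by (simp add: lipschitz_primitive_by_parts[OF fg \<zeta>] integral_completion)
qed

section \<open>Primitives on the half-line and their reflections\<close>

lemma locally_bounded_integrable_on:
  assumes "g \<in> borel_measurable borel" "locally_bounded g"
  shows "g integrable_on {a..b::real}"
  using set_integrable_bounded_set(1)[OF assms(1) _ assms(2), of "{a..b}"]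
  by (intro set_borel_integral_eq_integral(1)) auto

lemma primitive_difference_bound:
  assumes g: "g \<in> borel_measurable borel" "locally_bounded g"
    and f: "\<And>t. 0 \<le> t \<Longrightarrow> f t = c + integral {0..t} g"
    and B: "0 \<le> B" "\<And>x. \<bar>x\<bar> \<le> R \<Longrightarrow> \<bar>g x\<bar> \<le> B"
    and st: "0 \<le> s" "0 \<le> t" "s \<le> R" "t \<le> R"
  shows "\<bar>f s - f t\<bar> \<le> B * \<bar>s - t\<bar>"
proof -
  have *: "\<bar>f b - f a\<bar> \<le> B * \<bar>b - a\<bar>" if "0 \<le> a" "a \<le> b" "b \<le> R" for a b
  proof -
    note i = locally_bounded_integrable_on[OF g]
    have "f b - f a = integral {a..b} g"
      using Henstock_Kurzweil_Integration.integral_combine[OF that(1,2) i] that by (simp add: f)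
    moreover have "norm (integral {a..b} g) \<le> B * measure lborel {a..b}"
      by (rule has_integral_bound_real[OF B(1) finite.emptyI integrable_integral[OF i]]) (use that B(2) in auto)
    ultimately show ?thesis using that by simp
  qed
  show ?thesis
    using *[of s t] *[of t s] st by (cases "s \<le> t") (auto simp: abs_minus_commute)
qed

text \<open>At a continuity point of \<open>g\<close> the fundamental theorem of calculus is
  elementary, and countably many exceptions form a null set. The even reflection of a primitive
  serves for \<open>u\<close>, the odd one for \<open>z\<close>; subtracting \<open>c\<close> makes
  the latter continuous at the origin.\<close>

lemma
  assumes g: "g \<in> borel_measurable borel" "locally_bounded g"
    and f: "\<And>t. 0 \<le> t \<Longrightarrow> f t = c + integral {0..t} g"
    and D: "countable D" "\<And>t. 0 < t \<Longrightarrow> t \<notin> D \<Longrightarrow> isCont g t"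
  shows primitive_has_deriv: "\<And>t. 0 < t \<Longrightarrow> t \<notin> D \<Longrightarrow> (f has_field_derivative g t) (at t)"
    and lipschitz_primitive_even: "lipschitz_primitive (\<lambda>x. f \<bar>x\<bar>) (\<lambda>x. sgn x * g \<bar>x\<bar>)"
    and lipschitz_primitive_odd: "lipschitz_primitive (\<lambda>x. sgn x * (f \<bar>x\<bar> - c)) (\<lambda>x. g \<bar>x\<bar>)"
proof -
  show deriv: "(f has_field_derivative g t) (at t)" if "0 < t" "t \<notin> D" for t
  proof -
    have "((\<lambda>u. integral {0..u} g) has_vector_derivative g t) (at t within {0..t + 1} - {})"
      by (rule integral_has_vector_derivative_continuous_at[OF locally_bounded_integrable_on[OF g]])
        (use that D(2)[of t] in \<open>auto intro: continuous_at_imp_continuous_within\<close>)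
    then have "((\<lambda>u. c + integral {0..u} g) has_vector_derivative g t) (at t within {0..t + 1})"
      by (auto intro!: derivative_eq_intros)
    moreover have "at t within {0..t + 1} = at t"
      using that by (intro at_within_interior) auto
    ultimately have "((\<lambda>u. c + integral {0..u} g) has_field_derivative g t) (at t)"
      by (simp add: has_real_derivative_iff_has_vector_derivative)
    then show ?thesis
      by (rule has_field_derivative_transform_within_open[of _ _ _ "{0<..}"]) (use that f in auto)
  qed
  have m: "(\<lambda>x. g \<bar>x\<bar>) \<in> borel_measurable borel" "(\<lambda>x. sgn x * g \<bar>x\<bar>) \<in> borel_measurable borel"
    using g(1) by measurable
  have "\<exists>B. \<forall>x. \<bar>x\<bar> \<le> R \<longrightarrow> \<bar>g \<bar>x\<bar>\<bar> \<le> B \<and> \<bar>sgn x * g \<bar>x\<bar>\<bar> \<le> B" for R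
  proof -
    obtain B where B: "\<And>x. \<bar>x\<bar> \<le> R \<Longrightarrow> \<bar>g x\<bar> \<le> B" using locally_boundedE[OF g(2)] by blast
    have "\<bar>sgn x * g \<bar>x\<bar>\<bar> \<le> \<bar>g \<bar>x\<bar>\<bar>" for x by (simp add: abs_mult abs_sgn_eq)
    then show ?thesis using B by (intro exI[of _ B]) (metis abs_abs order_trans)
  qed
  then have b: "locally_bounded (\<lambda>x. g \<bar>x\<bar>)" "locally_bounded (\<lambda>x. sgn x * g \<bar>x\<bar>)"
    unfolding locally_bounded_def by meson+
  have f0: "f 0 = c" using f[of 0] by simp
  have lip: "\<exists>L. \<forall>x y. \<bar>x\<bar> \<le> R \<and> \<bar>y\<bar> \<le> R \<longrightarrow> \<bar>f \<bar>x\<bar> - f \<bar>y\<bar>\<bar> \<le> L * \<bar>x - y\<bar> \<and>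
     \<bar>sgn x * (f \<bar>x\<bar> - c) - sgn y * (f \<bar>y\<bar> - c)\<bar> \<le> L * \<bar>x - y\<bar>" for R
  proof -
    obtain B where B: "0 \<le> B" "\<And>x. \<bar>x\<bar> \<le> R \<Longrightarrow> \<bar>g x\<bar> \<le> B" using locally_boundedE[OF g(2)] by blast
    note d = primitive_difference_bound[OF g f B]
    have e: "\<bar>f \<bar>x\<bar> - f \<bar>y\<bar>\<bar> \<le> B * \<bar>x - y\<bar>" if "\<bar>x\<bar> \<le> R" "\<bar>y\<bar> \<le> R" for x y
    proof -
      have "\<bar>f \<bar>x\<bar> - f \<bar>y\<bar>\<bar> \<le> B * \<bar>\<bar>x\<bar> - \<bar>y\<bar>\<bar>" using that by (intro d) auto
      also have "\<dots> \<le> B * \<bar>x - y\<bar>" using B(1) by (intro mult_left_mono) auto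
      finally show ?thesis .
    qed
    \<comment> \<open>On one side of the origin this is the estimate for the even reflection. Points
      on opposite sides are compared through the origin, where \<open>f\<close> equals
      \<open>c\<close> and the distances to 0 add up to the distance of the points.\<close>
    have "\<bar>sgn x * (f \<bar>x\<bar> - c) - sgn y * (f \<bar>y\<bar> - c)\<bar> \<le> B * \<bar>x - y\<bar>"
      if xy: "\<bar>x\<bar> \<le> R" "\<bar>y\<bar> \<le> R" for x y
    proof (cases "0 \<le> x * y")
      case True
      show ?thesis
      proof (cases "x = 0 \<or> y = 0")
        case True
        then show ?thesis using e[OF xy] f0 by (auto simp: sgn_if abs_minus_commute)
      next
        case False
        then have "sgn x = sgn y" using \<open>0 \<le> x * y\<close> by (auto simp: sgn_if zero_le_mult_iff)
        then show ?thesis using e[OF xy] False by (auto simp: sgn_if abs_minus_commute)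
      qed
    next
      case False
      have "\<bar>f \<bar>x\<bar> - c\<bar> \<le> B * \<bar>x\<bar>" "\<bar>f \<bar>y\<bar> - c\<bar> \<le> B * \<bar>y\<bar>"
        using d[where s = "\<bar>x\<bar>" and t = 0] d[where s = "\<bar>y\<bar>" and t = 0] xy f0 by auto
      moreover have "\<bar>x - y\<bar> = \<bar>x\<bar> + \<bar>y\<bar>" using False by (auto simp: zero_le_mult_iff)
      ultimately show ?thesis using False
        by (auto simp: sgn_if zero_le_mult_iff not_le distrib_left)
    qed
    then show ?thesis using e by blast
  qed
  \<comment> \<open>Both reflections may fail to be differentiable at the origin, at points of
    \<open>D\<close> and at their mirror images.\<close>
  define S where "S = insert 0 (D \<union> uminus ` D)"
  have "AE x in lborel. x \<notin> S"
    unfolding S_def using D(1) by (intro AE_not_in countable_imp_null_set_lborel) auto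
  then have ae: "AE x in lborel. ((\<lambda>x. f \<bar>x\<bar>) has_field_derivative sgn x * g \<bar>x\<bar>) (at x) \<and>
     ((\<lambda>x. sgn x * (f \<bar>x\<bar> - c)) has_field_derivative g \<bar>x\<bar>) (at x)"
  proof eventually_elim
    case (elim x)
    show ?case
    proof (cases "0 < x")
      case True
      have "(f has_field_derivative g x) (at x)" "((\<lambda>x. f x - c) has_field_derivative g x) (at x)"
        using deriv[of x] True elim by (auto simp: S_def intro!: derivative_eq_intros)
      then show ?thesis
        using True by (auto intro: has_field_derivative_transform_within_open[of _ _ _ "{0<..}"])
    next
      case False
      then have "x < 0" "- x \<notin> D" using elim by (auto simp: S_def) (metis image_eqI minus_minus)
      then have "(f has_field_derivative g (- x)) (at (- x))" by (intro deriv) auto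
      then have "((\<lambda>x. f (- x)) has_field_derivative - g (- x)) (at x)"
        by (simp add: DERIV_mirror)
      moreover from DERIV_minus[OF DERIV_diff[OF this DERIV_const[of c]]]
      have "((\<lambda>x. - (f (- x) - c)) has_field_derivative g (- x)) (at x)" by simp
      ultimately show ?thesis
        using \<open>x < 0\<close> by (auto intro: has_field_derivative_transform_within_open[of _ _ _ "{..<0}"])
    qed
  qed
  have "locally_lipschitz (\<lambda>x. f \<bar>x\<bar>)" "locally_lipschitz (\<lambda>x. sgn x * (f \<bar>x\<bar> - c))"
    unfolding locally_lipschitz_def using lip by blast+
  moreover from ae have "AE x in lborel. ((\<lambda>x. f \<bar>x\<bar>) has_field_derivative sgn x * g \<bar>x\<bar>) (at x)"
    "AE x in lborel. ((\<lambda>x. sgn x * (f \<bar>x\<bar> - c)) has_field_derivative g \<bar>x\<bar>) (at x)"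
    by (rule eventually_mono; simp)+
  ultimately show "lipschitz_primitive (\<lambda>x. f \<bar>x\<bar>) (\<lambda>x. sgn x * g \<bar>x\<bar>)"
    "lipschitz_primitive (\<lambda>x. sgn x * (f \<bar>x\<bar> - c)) (\<lambda>x. g \<bar>x\<bar>)"
    unfolding lipschitz_primitive_def using m b by blast+
qed

section \<open>The total variation measure\<close>

lemma bump_algebra_test_fun:
  assumes "f \<in> bump_algebra" "compact (closure {x. f x \<noteq> 0})" "closure {x. f x \<noteq> 0} \<subseteq> \<Omega>"
  shows "test_fun \<Omega> f"
  using assms bump_algebra_differentiable by (auto simp: test_fun_def)

text \<open>The limit is minus the sign because integration by parts turns the functional defining
  the variation into minus the integral of \<open>g\<close> against the test function. The
  exhaustion is applied separately to the positive and the negative part of \<open>V\<close>; thus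
  every approximant vanishes at 0 and has the right sign on each side.\<close>

lemma sign_approximation:
  fixes V :: "real set"
  assumes "open V"
  shows "\<exists>\<eta>. (\<forall>n::nat. test_fun V (\<eta> n) \<and> (\<forall>x. \<bar>\<eta> n x\<bar> \<le> 1) \<and> (\<forall>x. sgn x * \<eta> n x \<le> 0) \<and> \<eta> n 0 = 0) \<and>
    (\<forall>x\<in>V - {0}. (\<lambda>n. \<eta> n x) \<longlonglongrightarrow> - sgn x)"
proof -
  obtain a where a: "\<And>n. a n \<in> bump_algebra" "\<And>n. compact (closure {x. a n x \<noteq> 0})"
    "\<And>n. closure {x. a n x \<noteq> 0} \<subseteq> V \<inter> {0<..}" "\<And>n x. 0 \<le> a n x \<and> a n x \<le> 1"
    "\<And>x. x \<in> V \<inter> {0<..} \<Longrightarrow> (\<lambda>n::nat. a n x) \<longlonglongrightarrow> 1"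
    using bump_exhaustion[OF open_Int[OF assms open_greaterThan[of 0]]] by meson
  obtain b where b: "\<And>n. b n \<in> bump_algebra" "\<And>n. compact (closure {x. b n x \<noteq> 0})"
    "\<And>n. closure {x. b n x \<noteq> 0} \<subseteq> V \<inter> {..<0}" "\<And>n x. 0 \<le> b n x \<and> b n x \<le> 1"
    "\<And>x. x \<in> V \<inter> {..<0} \<Longrightarrow> (\<lambda>n::nat. b n x) \<longlonglongrightarrow> 1"
    using bump_exhaustion[OF open_Int[OF assms open_lessThan[of 0]]] by meson
  have a0: "a n x = 0" if "x \<le> 0" for n x
    using a(3)[of n] closure_subset[of "{x. a n x \<noteq> 0}"] that by fastforce
  have b0: "b n x = 0" if "0 \<le> x" for n x
    using b(3)[of n] closure_subset[of "{x. b n x \<noteq> 0}"] that by fastforce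
  define \<eta> where "\<eta> n x = b n x - a n x" for n x
  have "test_fun V (\<eta> n)" for n
  proof (rule bump_algebra_test_fun)
    show "\<eta> n \<in> bump_algebra"
      unfolding \<eta>_def by (rule bump_algebra_diff[OF b(1) a(1)])
    let ?C = "closure {x. a n x \<noteq> 0} \<union> closure {x. b n x \<noteq> 0}"
    have "{x. \<eta> n x \<noteq> 0} \<subseteq> {x. a n x \<noteq> 0} \<union> {x. b n x \<noteq> 0}"
      by (auto simp: \<eta>_def)
    then have sub: "closure {x. \<eta> n x \<noteq> 0} \<subseteq> ?C"
      using closure_mono by (metis closure_Un)
    then show "closure {x. \<eta> n x \<noteq> 0} \<subseteq> V"
      using a(3)[of n] b(3)[of n] by blast
    have "bounded ?C" using a(2) b(2) by (simp add: compact_imp_bounded)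
    then show "compact (closure {x. \<eta> n x \<noteq> 0})"
      using bounded_subset[OF _ sub] by (simp only: compact_eq_bounded_closed closed_closure simp_thms)
  qed
  moreover have "\<bar>\<eta> n x\<bar> \<le> 1" for n x
    using a(4)[of n x] b(4)[of n x] unfolding \<eta>_def by linarith
  moreover have "sgn x * \<eta> n x \<le> 0" for n x
    using a(4)[of n x] b(4)[of n x] a0[of x n] b0[of x n] by (auto simp: \<eta>_def sgn_if)
  moreover have "\<eta> n 0 = 0" for n
    using a0 b0 by (simp add: \<eta>_def)
  moreover have "(\<lambda>n. \<eta> n x) \<longlonglongrightarrow> - sgn x" if "x \<in> V - {0}" for x
  proof (cases "0 < x")
    case True
    then show ?thesis using that tendsto_minus[OF a(5)[of x]] b0[of x] by (simp add: \<eta>_def)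
  next
    case False
    then show ?thesis using that b(5)[of x] a0[of x] by (simp add: \<eta>_def)
  qed
  ultimately show ?thesis by (intro exI[of _ \<eta>]) simp
qed

lemma integrable_mult_test_fun:
  assumes g: "g \<in> borel_measurable borel" "locally_bounded g" and \<zeta>: "test_fun \<Omega> \<zeta>"
  shows "integrable lborel (\<lambda>x. g x * \<zeta> x)"
proof -
  obtain R where R: "\<And>x. R < \<bar>x\<bar> \<Longrightarrow> \<zeta> x = 0"
    using test_fun_bounded_support[OF \<zeta>] by blast
  have [measurable]: "\<zeta> \<in> borel_measurable borel"
    using test_fun_continuous[OF \<zeta>, of UNIV] by (auto intro: borel_measurable_continuous_onI)
  note g(1)[measurable]
  have "bounded (\<zeta> ` {-R..R})"
    by (intro compact_imp_bounded compact_continuous_image test_fun_continuous[OF \<zeta>]) simp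
  then obtain M where M: "0 < M" "\<And>x. x \<in> {-R..R} \<Longrightarrow> norm (\<zeta> x) \<le> M"
    by (auto simp: bounded_pos)
  have M': "\<bar>\<zeta> x\<bar> \<le> M" for x
  proof (cases "R < \<bar>x\<bar>")
    case False
    then have "x \<in> {-R..R}" unfolding atLeastAtMost_iff by linarith
    from M(2)[OF this] show ?thesis by simp
  qed (use M R in simp)
  have "set_integrable lborel {-R..R} (\<lambda>x. g x * \<zeta> x)"
  proof (rule set_integrable_bounded_set(1))
    show "locally_bounded (\<lambda>x. g x * \<zeta> x)"
      unfolding locally_bounded_def
    proof
      fix S
      obtain B where B: "0 \<le> B" "\<And>x. \<bar>x\<bar> \<le> S \<Longrightarrow> \<bar>g x\<bar> \<le> B" using locally_boundedE[OF g(2)] by blast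
      have "\<bar>g x * \<zeta> x\<bar> \<le> B * M" if "\<bar>x\<bar> \<le> S" for x
        unfolding abs_mult using B(1) B(2)[OF that] M'[of x] by (intro mult_mono) auto
      then show "\<exists>B. \<forall>x. \<bar>x\<bar> \<le> S \<longrightarrow> \<bar>g x * \<zeta> x\<bar> \<le> B" by blast
    qed
  qed auto
  moreover have "x \<in> {-R..R}" if "\<zeta> x \<noteq> 0" for x
  proof -
    have "\<not> R < \<bar>x\<bar>" using R[of x] that by blast
    then show ?thesis unfolding atLeastAtMost_iff by linarith
  qed
  then have "(\<lambda>x. indicator {-R..R} x *\<^sub>R (g x * \<zeta> x)) = (\<lambda>x. g x * \<zeta> x)"
    by (fastforce simp: fun_eq_iff indicator_def)
  ultimately show ?thesis unfolding set_integrable_def by simp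
qed

text \<open>The sign condition makes minus the sign of x an optimal direction. The upper bound is
  integration by parts with \<open>\<bar>\<zeta> x\<bar> \<le> 1\<close>; the lower bound tests with
  the sign approximations. Fatou's lemma is used there, since \<open>V\<close> may be unbounded and
  the integral infinite.\<close>

lemma variation_lipschitz_primitive:
  assumes ug: "lipschitz_primitive u g" and sg: "\<And>x. 0 \<le> sgn x * g x" and V: "open V"
  shows "variation u V = (\<integral>\<^sup>+x\<in>V. ennreal \<bar>g x\<bar> \<partial>lborel)"
proof (rule antisym)
  note gm = lipschitz_primitiveD(3,4)[OF ug]
  note [measurable] = gm(1) borel_open[OF V]
  show "variation u V \<le> (\<integral>\<^sup>+x\<in>V. ennreal \<bar>g x\<bar> \<partial>lborel)"
    unfolding variation_def
  proof (rule SUP_least, clarify)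
    fix \<zeta> assume \<zeta>: "test_fun V \<zeta>" "\<forall>x. \<bar>\<zeta> x\<bar> \<le> 1"
    have "ennreal (LINT x|lebesgue. u x * deriv \<zeta> x) \<le> ennreal (norm (\<integral>x. g x * \<zeta> x \<partial>lborel))"
      unfolding lipschitz_primitive_by_parts[OF ug \<zeta>(1)] by (intro ennreal_leI) simp
    also have "\<dots> \<le> (\<integral>\<^sup>+x. ennreal (norm (g x * \<zeta> x)) \<partial>lborel)"
      by (rule integral_norm_bound_ennreal[OF integrable_mult_test_fun[OF gm \<zeta>(1)]])
    also have "\<dots> \<le> (\<integral>\<^sup>+x\<in>V. ennreal \<bar>g x\<bar> \<partial>lborel)"
    proof (rule nn_integral_mono)
      fix x
      show "ennreal (norm (g x * \<zeta> x)) \<le> ennreal \<bar>g x\<bar> * indicator V x"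
      proof (cases "\<zeta> x = 0")
        case False
        then have "x \<in> V" by (rule test_fun_support[OF \<zeta>(1)])
        then show ?thesis using \<zeta>(2) by (auto simp: abs_mult intro!: ennreal_leI mult_left_le)
      qed simp
    qed
    finally show "ennreal (LINT x|lebesgue. u x * deriv \<zeta> x) \<le> (\<integral>\<^sup>+x\<in>V. ennreal \<bar>g x\<bar> \<partial>lborel)" .
  qed
  obtain \<eta> where \<eta>: "\<And>n::nat. test_fun V (\<eta> n)" "\<And>n x. \<bar>\<eta> n x\<bar> \<le> 1" "\<And>n x. sgn x * \<eta> n x \<le> 0"
    "\<And>n. \<eta> n 0 = 0" "\<And>x. x \<in> V - {0} \<Longrightarrow> (\<lambda>n. \<eta> n x) \<longlonglongrightarrow> - sgn x"
    using sign_approximation[OF V] by blast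
  have [measurable]: "\<eta> n \<in> borel_measurable borel" for n
    using test_fun_continuous[OF \<eta>(1), of UNIV n] by (auto intro: borel_measurable_continuous_onI)
  \<comment> \<open>The hypothesis on \<open>g\<close> is void at the origin, since
    \<open>sgn 0 = 0\<close>; there \<open>\<eta> n 0 = 0\<close> takes over.\<close>
  have nn: "g x * \<eta> n x \<le> 0" for n x
    using sg[of x] \<eta>(3)[of x n] \<eta>(4)[of n]
    by (cases x "0::real" rule: linorder_cases) (auto simp: mult_le_0_iff)
  have eq: "(\<integral>\<^sup>+x. ennreal (- (g x * \<eta> n x)) \<partial>lborel) \<le> variation u V" for n
  proof -
    have "ennreal (LINT x|lebesgue. u x * deriv (\<eta> n) x) \<le> variation u V"
      unfolding variation_def using \<eta>(1,2) by (intro SUP_upper) auto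
    also have "(LINT x|lebesgue. u x * deriv (\<eta> n) x) = (\<integral>x. - (g x * \<eta> n x) \<partial>lborel)"
      using lipschitz_primitive_by_parts[OF ug \<eta>(1)] by simp
    also have "ennreal \<dots> = (\<integral>\<^sup>+x. ennreal (- (g x * \<eta> n x)) \<partial>lborel)"
      using nn by (intro nn_integral_eq_integral[symmetric] integrable_minus integrable_mult_test_fun[OF gm \<eta>(1)]) auto
    finally show ?thesis .
  qed
  have "(\<integral>\<^sup>+x\<in>V. ennreal \<bar>g x\<bar> \<partial>lborel) \<le> (\<integral>\<^sup>+x. liminf (\<lambda>n. ennreal (- (g x * \<eta> n x))) \<partial>lborel)"
  proof (rule nn_integral_mono_AE)
    have "AE x in lborel. x \<noteq> (0::real)"
      using AE_not_in[OF countable_imp_null_set_lborel[of "{0::real}"]] by simp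
    then show "AE x in lborel. ennreal \<bar>g x\<bar> * indicator V x \<le> liminf (\<lambda>n. ennreal (- (g x * \<eta> n x)))"
    proof eventually_elim
      case (elim x)
      show ?case
      proof (cases "x \<in> V")
        case True
        then have "(\<lambda>n. ennreal (- (g x * \<eta> n x))) \<longlonglongrightarrow> ennreal (- (g x * - sgn x))"
          using elim by (intro tendsto_intros \<eta>(5)) auto
        also have "- (g x * - sgn x) = \<bar>g x\<bar>"
          using sg[of x] elim by (cases "0 < x") (auto simp: sgn_if)
        finally have "liminf (\<lambda>n. ennreal (- (g x * \<eta> n x))) = ennreal \<bar>g x\<bar>"
          by (rule lim_imp_Liminf[OF trivial_limit_sequentially])
        then show ?thesis using True by simp
      qed simp
    qed
  qed
  also have "\<dots> \<le> liminf (\<lambda>n. \<integral>\<^sup>+x. ennreal (- (g x * \<eta> n x)) \<partial>lborel)"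
    by (rule nn_integral_liminf) measurable
  also have "\<dots> \<le> variation u V"
    using eq by (intro Liminf_le) auto
  finally show "(\<integral>\<^sup>+x\<in>V. ennreal \<bar>g x\<bar> \<partial>lborel) \<le> variation u V" .
qed

text \<open>\<open>measure_of\<close> keeps a set function only if it is a measure, so the outer
  extension has to be evaluated on every Borel set. Lebesgue measure is outer regular, and the
  global bound \<open>M\<close> converts a small excess in Lebesgue measure into a small excess in
  variation.\<close>

lemma total_variation_measure_lipschitz_primitive:
  assumes ug: "lipschitz_primitive u g" and sg: "\<And>x. 0 \<le> sgn x * g x" and M: "\<And>x. \<bar>g x\<bar> \<le> M"
  shows "total_variation_measure u = density lborel (\<lambda>x. ennreal \<bar>g x\<bar>)"
proof -
  have [measurable]: "g \<in> borel_measurable borel"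
    by (rule lipschitz_primitiveD(3)[OF ug])
  let ?\<mu> = "density lborel (\<lambda>x. ennreal \<bar>g x\<bar>)"
  have M0: "0 \<le> M" using M[of 0] by linarith
  have var: "variation u V = emeasure ?\<mu> V" if "open V" for V
    using variation_lipschitz_primitive[OF ug sg that] borel_open[OF that] by (simp add: emeasure_density)
  have "(INF V\<in>{V. open V \<and> B \<subseteq> V}. variation u V) = emeasure ?\<mu> B" if B[measurable]: "B \<in> sets borel" for B
  proof (rule antisym)
    show "emeasure ?\<mu> B \<le> (INF V\<in>{V. open V \<and> B \<subseteq> V}. variation u V)"
      by (rule INF_greatest) (auto simp: var intro!: emeasure_mono)
    show "(INF V\<in>{V. open V \<and> B \<subseteq> V}. variation u V) \<le> emeasure ?\<mu> B"
    proof (rule ennreal_le_epsilon)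
      fix e :: real assume "0 < e"
      \<comment> \<open>Dividing by \<open>M + 1\<close> instead of \<open>M\<close> keeps the
        denominator positive when \<open>M = 0\<close>.\<close>
      then have "0 < e / (M + 1)" using M0 by simp
      then obtain U where U: "open U" "B \<subseteq> U" "emeasure lborel (U - B) < e / (M + 1)"
        using outer_regular_lborel[OF B] by blast
      note [measurable] = borel_open[OF U(1)]
      have "emeasure ?\<mu> (U - B) = (\<integral>\<^sup>+x\<in>U - B. ennreal \<bar>g x\<bar> \<partial>lborel)"
        by (simp add: emeasure_density)
      also have "\<dots> \<le> (\<integral>\<^sup>+x\<in>U - B. ennreal (M + 1) \<partial>lborel)"
        using M by (intro nn_integral_mono mult_right_mono ennreal_leI) (auto intro: add_increasing2)
      also have "\<dots> = ennreal (M + 1) * emeasure lborel (U - B)"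
        by (simp add: nn_integral_cmult_indicator)
      also have "\<dots> \<le> ennreal (M + 1) * ennreal (e / (M + 1))"
        using U(3) by (intro mult_left_mono) auto
      also have "\<dots> = ennreal e"
        using M0 \<open>0 < e\<close> by (subst ennreal_mult[symmetric]) auto
      finally have "emeasure ?\<mu> (U - B) \<le> ennreal e" .
      moreover have "emeasure ?\<mu> U = emeasure ?\<mu> B + emeasure ?\<mu> (U - B)"
        using U(2) by (subst plus_emeasure) (auto simp: Un_absorb1)
      moreover have "(INF V\<in>{V. open V \<and> B \<subseteq> V}. variation u V) \<le> emeasure ?\<mu> U"
        using U var[OF U(1)] by (metis (mono_tags, lifting) INF_lower mem_Collect_eq)
      ultimately show "(INF V\<in>{V. open V \<and> B \<subseteq> V}. variation u V) \<le> emeasure ?\<mu> B + ennreal e"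
        by (metis add_left_mono order_trans)
    qed
  qed
  then have "total_variation_measure u = measure_of UNIV (sets borel) (emeasure ?\<mu>)"
    unfolding total_variation_measure_def
    using sets.sigma_sets_eq[of "borel :: real measure"]
    by (intro measure_of_eq) (simp_all only: space_borel Pow_UNIV subset_UNIV)
  also have "\<dots> = ?\<mu>"
    using measure_of_of_measure[of ?\<mu>] by simp
  finally show ?thesis .
qed

section \<open>Convergence tools and solution profiles\<close>

text \<open>Closedness of \<open>S\<close> makes a closed ball around a point, intersected with
  \<open>S\<close>, compact; one Hoelder constant then serves near that point.\<close>

lemma holder_loc_continuous_on:
  fixes f :: "'a::heine_borel \<Rightarrow> real"
  assumes "0 < \<theta>" "holder_loc \<theta> S f" "closed S"
  shows "continuous_on S f"
  unfolding continuous_on_def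
proof
  fix a assume "a \<in> S"
  have "compact (cball a 1 \<inter> S)"
    using \<open>closed S\<close> by (simp add: compact_Int_closed)
  then obtain L where L: "\<And>x. x \<in> cball a 1 \<inter> S \<Longrightarrow> \<bar>f x - f a\<bar> \<le> L * dist x a powr \<theta>"
    using assms(2) \<open>a \<in> S\<close> unfolding holder_loc_def
    by (metis IntI Int_lower2 centre_in_cball zero_le_one)
  have "((\<lambda>x. dist x a) \<longlongrightarrow> 0) (at a within S)"
    by (auto intro!: tendsto_eq_intros)
  then have "((\<lambda>x. dist x a powr \<theta>) \<longlongrightarrow> 0) (at a within S)"
    using \<open>0 < \<theta>\<close> by (intro tendsto_zero_powrI[OF _ tendsto_const]) auto
  then have "((\<lambda>x. L * dist x a powr \<theta>) \<longlongrightarrow> 0) (at a within S)"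
    by (rule tendsto_mult_right_zero)
  moreover have "eventually (\<lambda>x. norm (f x - f a) \<le> L * dist x a powr \<theta>) (at a within S)"
    unfolding eventually_at using L by (intro exI[of _ 1]) (auto simp: dist_commute)
  ultimately have "((\<lambda>x. f x - f a) \<longlongrightarrow> 0) (at a within S)"
    by (rule Lim_null_comparison[rotated])
  then show "(f \<longlongrightarrow> f a) (at a within S)" by (simp add: LIM_zero_iff)
qed

text \<open>Uniformity controls the change of function at the moving point, continuity of
  \<open>g\<close> the motion itself. It is applied to the nonlinearities evaluated along the
  solutions.\<close>

lemma uniform_limit_compose_tendsto:
  fixes f :: "nat \<Rightarrow> 'a::topological_space \<Rightarrow> real"
  assumes u: "uniform_limit C f g sequentially" and g: "continuous_on C g"
    and x: "x \<longlonglongrightarrow> a" "a \<in> C" "\<And>j. x j \<in> C"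
  shows "(\<lambda>j. f j (x j)) \<longlonglongrightarrow> g a"
proof -
  have "(\<lambda>j. f j (x j) - g (x j)) \<longlonglongrightarrow> 0"
  proof (rule tendstoI)
    fix e :: real assume "0 < e"
    from uniform_limitD[OF u this] show "\<forall>\<^sub>F j in sequentially. dist (f j (x j) - g (x j)) 0 < e"
      by eventually_elim (use x(3) in \<open>auto simp: dist_real_def\<close>)
  qed
  moreover have "(\<lambda>j. g (x j)) \<longlonglongrightarrow> g a"
    using continuous_on_tendsto_compose[OF g x(1,2)] x(3) by simp
  ultimately show ?thesis using tendsto_add by fastforce
qed

text \<open>Convergence of the nonlinearities bounds only the tail of the sequence; the finitely
  many remaining members have bounds of their own, and a maximum covers them.\<close>

lemma uniformly_bounded_if_eventually:
  fixes P :: "nat \<Rightarrow> real \<Rightarrow> bool"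
  assumes "\<And>j. \<exists>B. P j B" and "\<exists>B. \<forall>\<^sub>F j in sequentially. P j B"
    and mono: "\<And>j B B'. P j B \<Longrightarrow> B \<le> B' \<Longrightarrow> P j B'"
  shows "\<exists>B. \<forall>j. P j B"
proof -
  obtain b where b: "\<And>j. P j (b j)" using assms(1) by metis
  obtain B N where B: "\<And>j. N \<le> j \<Longrightarrow> P j B"
    using assms(2) by (auto simp: eventually_sequentially)
  define M where "M = Max (insert B (b ` {..<N}))"
  have "P j M" for j
  proof (cases "N \<le> j")
    case True
    show ?thesis by (rule mono[OF B[OF True]]) (simp add: M_def)
  next
    case False
    show ?thesis by (rule mono[OF b]) (use False in \<open>auto simp: M_def intro!: Max_ge\<close>)
  qed
  then show ?thesis by blast
qed

definition uniformly_locally_bounded :: "(nat \<Rightarrow> real \<Rightarrow> real) \<Rightarrow> bool" where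
  "uniformly_locally_bounded f \<longleftrightarrow> (\<forall>R. \<exists>B. \<forall>j x. \<bar>x\<bar> \<le> R \<longrightarrow> \<bar>f j x\<bar> \<le> B)"

lemma uniformly_locally_bounded_imp: "uniformly_locally_bounded f \<Longrightarrow> locally_bounded (f j)"
  unfolding uniformly_locally_bounded_def locally_bounded_def by blast

text \<open>The distance of the primitives at any \<open>t\<close> in the interval is at most the L1
  distance \<open>a j\<close> of the integrands, which does not depend on \<open>t\<close> and tends
  to 0 by dominated convergence. Omitting the origin from the interval matches the hypothesis, which
  speaks of positive times only.\<close>

lemma uniform_limit_integral:
  fixes f :: "nat \<Rightarrow> real \<Rightarrow> real"
  assumes f: "\<And>j. f j \<in> borel_measurable borel" "uniformly_locally_bounded f"
    and g: "g \<in> borel_measurable borel" "locally_bounded g"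
    and lim: "AE t in lborel. 0 < t \<longrightarrow> (\<lambda>j. f j t) \<longlonglongrightarrow> g t"
  shows "uniform_limit {0..R} (\<lambda>j t. integral {0..t} (f j)) (\<lambda>t. integral {0..t} g) sequentially"
proof -
  note [measurable] = f(1) g(1)
  obtain B where B: "\<And>j x. \<bar>x\<bar> \<le> R \<Longrightarrow> \<bar>f j x\<bar> \<le> B"
    using f(2) unfolding uniformly_locally_bounded_def by meson
  obtain C where C: "0 \<le> C" "\<And>x. \<bar>x\<bar> \<le> R \<Longrightarrow> \<bar>g x\<bar> \<le> C" using locally_boundedE[OF g(2)] by blast
  define a where "a j = (\<integral>t. indicator {0<..R} t * \<bar>f j t - g t\<bar> \<partial>lborel)" for j
  have Bint: "integrable lborel (\<lambda>t. indicator {0<..R} t * (B + C))"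
    using emeasure_bounded_finite[of "{0<..R}"]
    by (intro integrable_mult_left integrable_real_indicator) simp_all
  have bd: "indicator {0<..R} t * \<bar>f j t - g t\<bar> \<le> indicator {0<..R} t * (B + C)" for j t
    using B[of t j] C(2)[of t] by (auto simp: indicator_def)
  have aint: "integrable lborel (\<lambda>t. indicator {0<..R} t * \<bar>f j t - g t\<bar>)" for j
    by (rule Bochner_Integration.integrable_bound[OF Bint])
       (use bd in \<open>auto intro!: AE_I2 intro: order_trans[OF _ abs_ge_self]\<close>)
  have "a \<longlonglongrightarrow> (\<integral>t. 0 \<partial>(lborel :: real measure))"
    unfolding a_def
  proof (rule integral_dominated_convergence[OF _ _ Bint])
    show "AE t in lborel. (\<lambda>j. indicator {0<..R} t * \<bar>f j t - g t\<bar>) \<longlonglongrightarrow> 0"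
      using lim
    proof eventually_elim
      case (elim t)
      show ?case
      proof (cases "0 < t")
        case True
        then have "(\<lambda>j. f j t) \<longlonglongrightarrow> g t" using elim by simp
        then have "(\<lambda>j. indicator {0<..R} t * \<bar>f j t - g t\<bar>) \<longlonglongrightarrow> indicator {0<..R} t * \<bar>g t - g t\<bar>"
          by (intro tendsto_intros)
        then show ?thesis by simp
      qed simp
    qed
  qed (use bd in \<open>auto intro!: AE_I2\<close>)
  then have a0: "a \<longlonglongrightarrow> 0" by simp
  have le: "\<bar>integral {0..t} (f j) - integral {0..t} g\<bar> \<le> a j" if "t \<in> {0..R}" for t j
  proof -
    have si: "set_integrable lborel {0..t} (f j)" "set_integrable lborel {0..t} g"
      using f g uniformly_locally_bounded_imp[OF f(2)] by (auto intro!: set_integrable_bounded_set(1))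
    then have "integral {0..t} (f j) - integral {0..t} g = (LINT s:{0..t}|lborel. f j s - g s)"
      by (simp add: set_borel_integral_eq_integral(2) set_integral_diff(2))
    also have "\<bar>\<dots>\<bar> \<le> (\<integral>s. \<bar>indicator {0..t} s *\<^sub>R (f j s - g s)\<bar> \<partial>lborel)"
      unfolding set_lebesgue_integral_def by (rule integral_abs_bound)
    also have "\<dots> \<le> a j"
      unfolding a_def
    proof (rule integral_mono_AE)
      show "integrable lborel (\<lambda>s. \<bar>indicator {0..t} s *\<^sub>R (f j s - g s)\<bar>)"
        using set_integral_diff(1)[OF si] by (intro integrable_abs) (simp add: set_integrable_def)
      have "AE s in lborel. s \<noteq> (0::real)"
        using AE_not_in[OF countable_imp_null_set_lborel[of "{0::real}"]] by simp
      then show "AE s in lborel. \<bar>indicator {0..t} s *\<^sub>R (f j s - g s)\<bar> \<le> indicator {0<..R} s * \<bar>f j s - g s\<bar>"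
        by eventually_elim (use that in \<open>auto simp: indicator_def\<close>)
    qed (rule aint)
    finally show ?thesis .
  qed
  show ?thesis
  proof (rule uniform_limitI)
    fix e :: real assume "0 < e"
    then have "eventually (\<lambda>j. a j < e) sequentially"
      using order_tendstoD(2)[OF a0] by blast
    then show "\<forall>\<^sub>F j in sequentially. \<forall>t\<in>{0..R}. dist (integral {0..t} (f j)) (integral {0..t} g) < e"
      by eventually_elim (auto simp: dist_real_def intro: le_less_trans[OF le])
  qed
qed

lemma locally_uniform_limit_halfline:
  assumes "\<And>R. uniform_limit {0..R} f g \<F>"
  shows "locally_uniform_limit {0::real..} f g \<F>"
  unfolding locally_uniform_limit_def
proof (intro allI impI)
  fix C :: "real set" assume C: "compact C \<and> C \<subseteq> {0..}"
  then obtain R where "\<forall>x\<in>C. norm x \<le> R"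
    using compact_imp_bounded bounded_iff by blast
  then have "C \<subseteq> {0..R}" using C by force
  then show "uniform_limit C f g \<F>" by (rule uniform_limit_on_subset[OF assms])
qed

lemma Linf_cong:
  assumes "Linf V f" "\<And>x. x \<in> V \<Longrightarrow> f x = f' x"
  shows "Linf V f'"
proof -
  have "(\<lambda>x. indicator V x *\<^sub>R f x) = (\<lambda>x. indicator V x *\<^sub>R f' x)"
    using assms(2) by (auto simp: fun_eq_iff indicator_def)
  moreover have "(x \<in> V \<longrightarrow> \<bar>f x\<bar> \<le> B) = (x \<in> V \<longrightarrow> \<bar>f' x\<bar> \<le> B)" for x B
    using assms(2) by auto
  ultimately show ?thesis
    using assms(1) by (simp add: Linf_def set_borel_measurable_def)
qed

lemma Linf_loc_cong:
  assumes "Linf_loc \<Omega> f" "\<And>x. x \<in> \<Omega> \<Longrightarrow> f x = f' x"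
  shows "Linf_loc \<Omega> f'"
  unfolding Linf_loc_def
proof (intro allI impI)
  fix V assume V: "compactly_inside V \<Omega>"
  then have "V \<subseteq> \<Omega>" using closure_subset unfolding compactly_inside_def by blast
  then show "Linf V f'"
    using assms V by (intro Linf_cong[of V f f']) (auto simp: Linf_loc_def)
qed

text \<open>A uniform bound \<open>B\<close> gives the majorant \<open>B\<close> times the modulus
  of \<psi>. The given functions \<open>f'\<close> matter only at positive times; \<open>f\<close>
  is a Borel extension of them to the line.\<close>

lemma weakstar_loc_dominated:
  assumes f: "\<And>j. f j \<in> borel_measurable borel" "uniformly_locally_bounded f"
    and g: "g \<in> borel_measurable borel" "locally_bounded g"
    and lim: "AE t in lborel. 0 < t \<longrightarrow> (\<lambda>j. f j t) \<longlonglongrightarrow> g t"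
    and eq: "\<And>j t. 0 < t \<Longrightarrow> f j t = f' j t"
  shows "weakstar_loc {0<..} f' g"
  unfolding weakstar_loc_def
proof (intro conjI allI impI)
  show "Linf_loc {0<..} (f' j)" for j
    by (rule Linf_loc_cong[OF Linf_loc_locally_bounded[OF f(1) uniformly_locally_bounded_imp[OF f(2)]]])
      (simp add: eq)
  show "Linf_loc {0<..} g"
    by (rule Linf_loc_locally_bounded[OF g])
  fix V and \<psi> :: "real \<Rightarrow> real" assume *: "compactly_inside V {0<..} \<and> set_integrable lebesgue V \<psi>"
  then have V: "V \<in> sets borel" "bounded V" "V \<subseteq> {0<..}"
    using compactly_insideD[of V] closure_subset[of V] unfolding compactly_inside_def by auto
  have \<psi>: "integrable lebesgue (\<lambda>x. indicator V x *\<^sub>R \<psi> x)"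
    using * by (simp add: set_integrable_def)
  have [measurable]: "(\<lambda>x. indicator V x *\<^sub>R \<psi> x) \<in> borel_measurable lebesgue"
    by (rule borel_measurable_integrable[OF \<psi>])
  have [measurable]: "f j \<in> borel_measurable lebesgue" "g \<in> borel_measurable lebesgue" for j
    using f(1) g(1) by (auto intro: measurable_completion)
  obtain R where R: "\<And>x. x \<in> V \<Longrightarrow> \<bar>x\<bar> \<le> R"
    using V(2) by (auto simp: bounded_iff)
  obtain B where B: "\<And>j x. \<bar>x\<bar> \<le> R \<Longrightarrow> \<bar>f j x\<bar> \<le> B"
    using f(2) unfolding uniformly_locally_bounded_def by meson
  have "(\<lambda>j. \<integral>x. f j x * (indicator V x *\<^sub>R \<psi> x) \<partial>lebesgue) \<longlonglongrightarrow> (\<integral>x. g x * (indicator V x *\<^sub>R \<psi> x) \<partial>lebesgue)"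
  proof (rule integral_dominated_convergence[where w = "\<lambda>x. B * \<bar>indicator V x *\<^sub>R \<psi> x\<bar>"])
    show "integrable lebesgue (\<lambda>x. B * \<bar>indicator V x *\<^sub>R \<psi> x\<bar>)"
      using \<psi> by (intro integrable_mult_right integrable_abs)
    show "AE x in lebesgue. (\<lambda>j. f j x * (indicator V x *\<^sub>R \<psi> x)) \<longlonglongrightarrow> g x * (indicator V x *\<^sub>R \<psi> x)"
      using AE_completion[OF lim]
    proof eventually_elim
      case (elim x)
      show ?case
      proof (cases "x \<in> V")
        case True
        then show ?thesis using elim V(3) by (intro tendsto_intros) auto
      qed simp
    qed
    show "AE x in lebesgue. norm (f j x * (indicator V x *\<^sub>R \<psi> x)) \<le> B * \<bar>indicator V x *\<^sub>R \<psi> x\<bar>" for j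
      using B R by (intro AE_I2) (auto simp: abs_mult indicator_def intro!: mult_right_mono)
  qed measurable
  moreover have "(\<integral>x. f j x * (indicator V x *\<^sub>R \<psi> x) \<partial>lebesgue) = (LINT t:V|lebesgue. f' j t * \<psi> t)" for j
    unfolding set_lebesgue_integral_def
    using V(3) eq by (intro Bochner_Integration.integral_cong) (auto simp: indicator_def)
  moreover have "(\<integral>x. g x * (indicator V x *\<^sub>R \<psi> x) \<partial>lebesgue) = (LINT t:V|lebesgue. g t * \<psi> t)"
    unfolding set_lebesgue_integral_def
    by (intro Bochner_Integration.integral_cong) (auto simp: indicator_def)
  ultimately show "(\<lambda>j. LINT t:V|lebesgue. f' j t * \<psi> t) \<longlonglongrightarrow> (LINT t:V|lebesgue. g t * \<psi> t)"
    by simp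
qed

text \<open>The equation is used through its integrated form, which exhibits the power
  \<open>q - 1\<close> of the slope as the primitive of a nonnegative function. As
  \<open>q > 1\<close>, that power is strictly increasing on the half-line, so the slope itself is
  nondecreasing.\<close>

lemma solution_profile_properties:
  assumes sp: "solution_profile l \<xi>1 \<xi>2 q b F y" and q: "1 < q" and F: "\<forall>a\<in>orthant3. 0 \<le> F a"
  shows "continuous_on {0..} (hderiv y)"
    and "\<And>t. 0 \<le> t \<Longrightarrow> (y has_vector_derivative hderiv y t) (at t within {0..})"
    and "continuous_on {0..} (k_fun F b y)"
    and "\<And>t. 0 \<le> t \<Longrightarrow> 0 \<le> k_fun F b y t"
    and "\<And>t. 0 \<le> t \<Longrightarrow> G_fun F b y t = hderiv y t powr (q - 1)"
    and "mono_on {0..} (hderiv y)"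
proof -
  define u where "u x = y \<bar>x\<bar>" for x
  have cs: "classical_solution q b F u" and y0: "y 0 = 1" "hderiv y 0 = 0"
    and bd: "\<And>t. 0 \<le> t \<Longrightarrow> 1 \<le> y t" "\<And>t. 0 \<le> t \<Longrightarrow> 0 \<le> hderiv y t"
    using sp unfolding solution_profile_def u_def by auto
  define w where "w x = \<bar>deriv u x\<bar> powr (q - 2) * deriv u x" for x
  have C1: "\<And>x. (f has_vector_derivative deriv f x) (at x)" "continuous_on UNIV (deriv f)"
    if "f C1_differentiable_on UNIV" for f :: "real \<Rightarrow> real"
  proof -
    obtain D where D: "\<And>x. (f has_vector_derivative D x) (at x)" "continuous_on UNIV D"
      using \<open>f C1_differentiable_on UNIV\<close> unfolding C1_differentiable_on_def by auto
    then have "deriv f = D"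
      by (auto intro!: ext DERIV_imp_deriv simp: has_real_derivative_iff_has_vector_derivative)
    then show "\<And>x. (f has_vector_derivative deriv f x) (at x)" "continuous_on UNIV (deriv f)"
      using D by auto
  qed
  have u: "\<And>x. (u has_vector_derivative deriv u x) (at x)" "continuous_on UNIV (deriv u)"
    using C1[of u] cs unfolding classical_solution_def by auto
  have w: "\<And>x. (w has_vector_derivative deriv w x) (at x)" "continuous_on UNIV (deriv w)"
    and weq: "\<And>x. deriv w x = F (\<bar>x\<bar>, u x, \<bar>deriv u x\<bar>) * u x powr (- b)"
    using C1[of w] cs unfolding classical_solution_def w_def[abs_def] by auto
  have yd: "(y has_vector_derivative deriv u t) (at t within {0..})" if "0 \<le> t" for t
    by (rule has_vector_derivative_transform[OF _ _ has_vector_derivative_at_within[OF u(1)]])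
       (use that in \<open>auto simp: u_def\<close>)
  have hd: "hderiv y t = deriv u t" if "0 \<le> t" for t
  proof -
    \<comment> \<open>A one-sided derivative is unique only where the filter is nontrivial; at the
      origin this rests on the right-hand filter.\<close>
    have "at t within {0..} \<noteq> bot"
    proof
      assume "at t within {0..} = bot"
      moreover have "at_right t \<le> at t within {0..}" using that by (intro at_le) auto
      ultimately have "at_right t = bot" by (metis le_bot)
      then show False using trivial_limit_at_right_real[of t] by simp
    qed
    then show ?thesis unfolding hderiv_def by (rule vector_derivative_within[OF _ yd[OF that]])
  qed
  show "continuous_on {0..} (hderiv y)"
    by (rule continuous_on_eq[OF continuous_on_subset[OF u(2)]]) (auto simp: hd)
  show "(y has_vector_derivative hderiv y t) (at t within {0..})" if "0 \<le> t" for t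
    using yd[OF that] hd[OF that] by simp
  have k: "k_fun F b y t = deriv w t" if "0 \<le> t" for t
    using that bd(2)[OF that] by (simp add: k_fun_def weq hd u_def)
  show "continuous_on {0..} (k_fun F b y)"
    by (rule continuous_on_eq[OF continuous_on_subset[OF w(2)]]) (auto simp: k)
  show k0: "0 \<le> k_fun F b y t" if "0 \<le> t" for t
    using F bd[OF that] that by (auto simp: k_fun_def)
  \<comment> \<open>For a positive slope the exponents \<open>q - 2\<close> and 1 add up. For slope
    0 both sides are 0, because \<open>powr\<close> has value 0 at base 0.\<close>
  have w_eq: "w t = hderiv y t powr (q - 1)" if "0 \<le> t" for t
  proof (cases "hderiv y t = 0")
    case False
    then have "0 < deriv u t" using bd(2)[OF that] hd[OF that] by simp
    then show ?thesis
      using powr_add[of "deriv u t" "q - 2" 1] by (simp add: w_def hd that)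
  qed (use q in \<open>simp add: w_def hd[OF that, symmetric]\<close>)
  have G: "G_fun F b y t = hderiv y t powr (q - 1)" if "0 \<le> t" for t
  proof -
    have "(deriv w has_integral w t - w 0) {0..t}"
      by (rule fundamental_theorem_of_calculus[OF that has_vector_derivative_at_within[OF w(1)]])
    then have "(k_fun F b y has_integral w t - w 0) {0..t}"
      by (rule has_integral_eq[rotated]) (auto simp: k)
    then show ?thesis
      using w_eq[OF that] w_eq[of 0] y0 q by (simp add: G_fun_def integral_unique)
  qed
  then show "\<And>t. 0 \<le> t \<Longrightarrow> G_fun F b y t = hderiv y t powr (q - 1)" .
  show "mono_on {0..} (hderiv y)"
  proof (rule mono_onI)
    fix s t :: real assume st: "s \<in> {0..}" "t \<in> {0..}" "s \<le> t"
    have int: "k_fun F b y integrable_on {a..c}" if "0 \<le> a" for a c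
      using that by (intro integrable_continuous_real
          continuous_on_subset[OF \<open>continuous_on {0..} (k_fun F b y)\<close>]) auto
    have "hderiv y s powr (q - 1) \<le> hderiv y t powr (q - 1)"
      unfolding G[symmetric, of s, OF st(1)[unfolded atLeast_iff]] G[symmetric, of t, OF st(2)[unfolded atLeast_iff]]
        G_fun_def
      by (rule integral_subset_le) (use st int k0 in auto)
    then show "hderiv y s \<le> hderiv y t"
      using q bd(2)[of s] bd(2)[of t] st
      by (meson atLeast_iff diff_gt_0_iff_gt linorder_not_less powr_less_mono2)
  qed
qed

section \<open>The limit \<open>p \<down> 1\<close>\<close>

lemma halfline_weak_deriv:
  assumes "lipschitz_primitive (\<lambda>x. f \<bar>x\<bar>) (\<lambda>x. sgn x * g \<bar>x\<bar>)" "\<Omega> \<subseteq> {0<..}"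
  shows "weak_deriv \<Omega> f g"
  by (rule weak_deriv_cong[OF lipschitz_primitive_weak_deriv[OF assms(1)]]) (use assms(2) in auto)

lemma halfline_W1inf:
  assumes fg: "lipschitz_primitive (\<lambda>x. f \<bar>x\<bar>) (\<lambda>x. sgn x * g \<bar>x\<bar>)"
  shows "W1inf_loc_halfline f" "Linf_loc_halfline g"
proof -
  have *: "Linf {0<..<R} f" "Linf {0<..<R} g" for R
    by (rule Linf_cong[OF Linf_bounded_set[OF lipschitz_primitiveD(1)[OF fg] _ lipschitz_primitiveD(2)[OF fg]]]
        Linf_cong[OF Linf_bounded_set[OF lipschitz_primitiveD(3)[OF fg] _ lipschitz_primitiveD(4)[OF fg]]]; auto)+
  then show "Linf_loc_halfline g" by (simp add: Linf_loc_halfline_def)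
  have "weak_deriv {0<..<R} f g" for R
    by (rule halfline_weak_deriv[OF fg]) auto
  then show "W1inf_loc_halfline f"
    unfolding W1inf_loc_halfline_def W1inf_def using * by blast
qed

text \<open>The sequence after the selection step: \<open>w\<close> is the Helly limit of the derivatives, extended to
  \<open>t < 0\<close> by their value at the origin.\<close>

locale p_to_1_limit =
  fixes l \<xi>1 \<xi>2 :: real and q b :: "nat \<Rightarrow> real"
    and F :: "nat \<Rightarrow> real \<times> real \<times> real \<Rightarrow> real" and F1 :: "real \<times> real \<times> real \<Rightarrow> real"
    and y :: "nat \<Rightarrow> real \<Rightarrow> real" and w :: "real \<Rightarrow> real"
  assumes parameters: "0 \<le> l" "1 \<le> \<xi>1" "0 < \<xi>2"
    and q: "\<And>j. 1 < q j" "q \<longlonglongrightarrow> 1"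
    and b: "\<And>j. 0 \<le> b j" "\<And>j. b j \<le> q j - 1"
    and F_nonneg: "\<And>j. \<forall>a\<in>orthant3. 0 \<le> F j a"
    and F_lim: "\<And>C. compact C \<Longrightarrow> C \<subseteq> orthant3 \<Longrightarrow> uniform_limit C F F1 sequentially"
    and F1_cont: "continuous_on orthant3 F1"
    and sol: "\<And>j. solution_profile l \<xi>1 \<xi>2 (q j) (b j) (F j) (y j)"
    and w_mono: "mono w"
    and w_lim: "\<And>t. isCont w t \<Longrightarrow> (\<lambda>j. hderiv (y j) (max 0 t)) \<longlonglongrightarrow> w t"
begin

lemmas profile = solution_profile_properties[OF sol q(1) F_nonneg]

definition D :: "real set" where "D = {t. \<not> isCont w t}"

text \<open>\<open>v\<close> and \<open>\<kappa>\<close> are frozen at their initial value for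
  negative times. They are then continuous on the line, hence Borel, as the convergence lemmas
  require.\<close>

definition v :: "nat \<Rightarrow> real \<Rightarrow> real" where "v j t = hderiv (y j) (max 0 t)"

definition \<kappa> :: "nat \<Rightarrow> real \<Rightarrow> real" where "\<kappa> j t = k_fun (F j) (b j) (y j) (max 0 t)"

definition Y :: "real \<Rightarrow> real" where "Y t = 1 + integral {0..t} w"

text \<open>The absolute values keep the argument in the orthant, where \<open>F1\<close> is
  continuous; \<open>K\<close> thereby is Borel and locally bounded on the whole line.\<close>

definition K :: "real \<Rightarrow> real" where "K t = F1 (\<bar>t\<bar>, Y \<bar>t\<bar>, w \<bar>t\<bar>)"

definition G :: "real \<Rightarrow> real" where "G t = integral {0..t} K"

text \<open>A compact part of the orthant containing the arguments met up to time \<open>R\<close>,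
  along every solution and along the limit. Uniform convergence along moving arguments is invoked
  here.\<close>

definition box :: "real \<Rightarrow> (real \<times> real \<times> real) set" where
  "box R = {0..R} \<times> {1..U_bound l \<xi>1 R} \<times> {0..\<xi>2}"

section \<open>The exceptional set and bounds for the slopes\<close>

lemma countable_D: "countable D"
  unfolding D_def by (rule mono_ctble_discont[OF w_mono])

lemma AE_notin_D: "AE t in lborel. t \<notin> D"
  by (rule AE_not_in[OF countable_imp_null_set_lborel[OF countable_D]])

lemma ex_notin_D:
  assumes "s < (t :: real)"
  shows "\<exists>r. s < r \<and> r < t \<and> r \<notin> D"
proof (rule ccontr)
  assume "\<not> ?thesis"
  then have "{s<..<t} \<subseteq> D" by auto
  then show False
    using uncountable_open_interval[of s t] assms countable_subset[OF _ countable_D] by auto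
qed

lemma y_bounds: "0 \<le> t \<Longrightarrow> 1 \<le> y j t" "0 \<le> t \<Longrightarrow> y j t \<le> U_bound l \<xi>1 t"
  and y_0: "y j 0 = 1"
  using sol[of j] by (auto simp: solution_profile_def)

lemma v_bounds: "0 \<le> v j t" "v j t \<le> \<xi>2"
  using sol[of j] by (auto simp: solution_profile_def v_def)

lemma v_tendsto: "t \<notin> D \<Longrightarrow> (\<lambda>j. v j t) \<longlonglongrightarrow> w t"
  unfolding v_def D_def using w_lim by blast

lemma AE_v_tendsto: "AE t in lborel. 0 < t \<longrightarrow> (\<lambda>j. v j t) \<longlonglongrightarrow> w t"
  using AE_notin_D by (rule eventually_mono) (simp add: v_tendsto)

text \<open>Convergence is known only off \<open>D\<close>. Since the complement of \<open>D\<close>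
  is dense, monotonicity transfers the bounds from a nearby point on the appropriate side.\<close>

lemma w_bounds: "0 \<le> w t" "w t \<le> \<xi>2"
proof -
  obtain r where r: "r < t" "r \<notin> D" using ex_notin_D[of "t - 1" t] by auto
  have "0 \<le> w r" by (rule LIMSEQ_le_const[OF v_tendsto[OF r(2)]]) (use v_bounds in auto)
  then show "0 \<le> w t" using monoD[OF w_mono, of r t] r by simp
  obtain r where r: "t < r" "r \<notin> D" using ex_notin_D[of t "t + 1"] by auto
  have "w r \<le> \<xi>2" by (rule LIMSEQ_le_const2[OF v_tendsto[OF r(2)]]) (use v_bounds in auto)
  then show "w t \<le> \<xi>2" using monoD[OF w_mono, of t r] r by simp
qed

lemma w_borel: "w \<in> borel_measurable borel"
  by (rule borel_measurable_mono[OF w_mono])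

lemma w_locally_bounded: "locally_bounded w"
  unfolding locally_bounded_def using w_bounds by (auto intro!: exI[of _ \<xi>2])

lemma continuous_on_max_0: "continuous_on {0..} f \<Longrightarrow> continuous_on UNIV (\<lambda>t. f (max 0 t))"
  for f :: "real \<Rightarrow> real"
  by (rule continuous_on_compose2[of "{0..}" f]) (auto intro!: continuous_intros)

lemma v_borel: "v j \<in> borel_measurable borel"
  unfolding v_def by (intro borel_measurable_continuous_onI continuous_on_max_0 profile(1))

lemma v_uniformly_locally_bounded: "uniformly_locally_bounded v"
  unfolding uniformly_locally_bounded_def using v_bounds by (auto intro!: exI[of _ \<xi>2])

lemma \<kappa>_continuous: "continuous_on UNIV (\<kappa> j)"
  unfolding \<kappa>_def by (rule continuous_on_max_0[OF profile(3)])

section \<open>Convergence of the profiles\<close>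

lemma y_eq:
  assumes "0 \<le> t"
  shows "y j t = 1 + integral {0..t} (v j)"
proof -
  have "(hderiv (y j) has_integral y j t - y j 0) {0..t}"
    using assms
    by (intro fundamental_theorem_of_calculus has_vector_derivative_within_subset[OF profile(2)]) auto
  then have "(v j has_integral y j t - y j 0) {0..t}"
    by (rule has_integral_eq[rotated]) (auto simp: v_def)
  then show ?thesis by (simp add: integral_unique y_0)
qed

lemma y_uniform_limit: "uniform_limit {0..R} y Y sequentially"
proof -
  have "uniform_limit {0..R} (\<lambda>j t. integral {0..t} (v j)) (\<lambda>t. integral {0..t} w) sequentially"
    by (rule uniform_limit_integral[OF v_borel v_uniformly_locally_bounded w_borel w_locally_bounded
          AE_v_tendsto])
  then have "uniform_limit {0..R} (\<lambda>j t. 1 + integral {0..t} (v j)) (\<lambda>t. 1 + integral {0..t} w) sequentially"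
    by (intro uniform_limit_intros)
  then show ?thesis
    by (rule uniform_limit_cong'[THEN iffD1, rotated 2]) (auto simp: y_eq Y_def)
qed

lemma y_tendsto: "0 \<le> t \<Longrightarrow> (\<lambda>j. y j t) \<longlonglongrightarrow> Y t"
  by (rule tendsto_uniform_limitI[OF y_uniform_limit[of t]]) simp

lemma Y_ge_1: "0 \<le> t \<Longrightarrow> 1 \<le> Y t"
  by (rule LIMSEQ_le_const[OF y_tendsto]) (use y_bounds in auto)

lemma Y_le: "0 \<le> t \<Longrightarrow> Y t \<le> U_bound l \<xi>1 t"
  by (rule LIMSEQ_le_const2[OF y_tendsto]) (use y_bounds in auto)

lemma U_bound_mono: "s \<le> t \<Longrightarrow> U_bound l \<xi>1 s \<le> U_bound l \<xi>1 t"
  unfolding U_bound_def using parameters by (intro mult_left_mono) auto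

lemma box_compact: "compact (box R)"
  unfolding box_def by (intro compact_Times) auto

lemma box_orthant: "box R \<subseteq> orthant3"
  unfolding box_def by auto

lemma box_limit: "0 \<le> t \<Longrightarrow> t \<le> R \<Longrightarrow> (t, Y t, w t) \<in> box R"
  unfolding box_def using Y_ge_1[of t] Y_le[of t] U_bound_mono[of t R] w_bounds by auto

lemma box_approx: "0 \<le> t \<Longrightarrow> t \<le> R \<Longrightarrow> (t, y j t, v j t) \<in> box R"
  unfolding box_def using y_bounds[of t j] U_bound_mono[of t R] v_bounds by auto

text \<open>The even reflection is \<open>u\<close>. The odd one is a summand of the product of
  \<open>u\<close> and \<open>z\<close>, to which it contributes the density of |Du|.\<close>

lemma Y_even: "lipschitz_primitive (\<lambda>x. Y \<bar>x\<bar>) (\<lambda>x. sgn x * w \<bar>x\<bar>)"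
  and Y_odd: "lipschitz_primitive (\<lambda>x. sgn x * (Y \<bar>x\<bar> - 1)) (\<lambda>x. w \<bar>x\<bar>)"
  by (rule lipschitz_primitive_even[OF w_borel w_locally_bounded Y_def countable_D]
      lipschitz_primitive_odd[OF w_borel w_locally_bounded Y_def countable_D]; simp add: D_def)+

lemma Y_isCont: "0 < t \<Longrightarrow> isCont Y t"
proof -
  assume t: "0 < t"
  have "isCont (\<lambda>x. Y \<bar>x\<bar>) t"
    using Y_even locally_lipschitz_continuous[of "\<lambda>x. Y \<bar>x\<bar>"]
    by (auto simp: lipschitz_primitive_def continuous_on_eq_continuous_at)
  moreover have "\<forall>\<^sub>F x in nhds t. Y \<bar>x\<bar> = Y x"
    using eventually_nhds_in_open[of "{0<..}" t] t by (auto elim: eventually_mono)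
  ultimately show "isCont Y t" using isCont_cong by fast
qed

section \<open>The limit of the densities\<close>

lemma F1_bounded_box: "\<exists>B. \<forall>a\<in>box R. \<bar>F1 a\<bar> \<le> B"
proof -
  have "bounded (F1 ` box R)"
    by (intro compact_imp_bounded compact_continuous_image box_compact
        continuous_on_subset[OF F1_cont box_orthant])
  then show ?thesis by (auto simp: bounded_iff)
qed

lemma K_borel: "K \<in> borel_measurable borel"
proof -
  have [measurable]: "(\<lambda>x. Y \<bar>x\<bar>) \<in> borel_measurable borel" "w \<in> borel_measurable borel"
    by (rule lipschitz_primitiveD[OF Y_even] w_borel)+
  have "(\<lambda>t. (\<bar>t\<bar>, Y \<bar>t\<bar>, w \<bar>t\<bar>)) \<in> borel \<rightarrow>\<^sub>M (borel :: (real \<times> real \<times> real) measure)"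
    by measurable
  then have "(\<lambda>t. (\<bar>t\<bar>, Y \<bar>t\<bar>, w \<bar>t\<bar>)) \<in> borel \<rightarrow>\<^sub>M restrict_space borel orthant3"
    using w_bounds(1) order_trans[OF zero_le_one Y_ge_1] by (intro measurable_restrict_space2) auto
  from measurable_compose[OF this borel_measurable_continuous_on_restrict[OF F1_cont]]
  show ?thesis unfolding K_def[abs_def] .
qed

lemma K_locally_bounded: "locally_bounded K"
  unfolding locally_bounded_def
proof
  fix R
  obtain B where B: "\<And>a. a \<in> box R \<Longrightarrow> \<bar>F1 a\<bar> \<le> B" using F1_bounded_box by blast
  have "\<bar>K x\<bar> \<le> B" if "\<bar>x\<bar> \<le> R" for x
    unfolding K_def by (rule B) (use that box_limit[of "\<bar>x\<bar>" R] in auto)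
  then show "\<exists>B. \<forall>x. \<bar>x\<bar> \<le> R \<longrightarrow> \<bar>K x\<bar> \<le> B" by blast
qed

lemma K_isCont:
  assumes "0 < t" "t \<notin> D"
  shows "isCont K t"
proof -
  have "((\<lambda>s. (s, Y s, w s)) \<longlongrightarrow> (t, Y t, w t)) (at t)"
    using Y_isCont[OF assms(1)] assms(2) by (intro tendsto_intros) (auto simp: D_def isCont_def)
  moreover have ev: "\<forall>\<^sub>F s in at t. s \<in> {0<..}"
    using assms(1) by (intro eventually_at_in_open') auto
  moreover have "\<forall>\<^sub>F s in at t. (s, Y s, w s) \<in> orthant3"
    using ev by eventually_elim (rule subsetD[OF box_orthant box_limit[OF _ order_refl]], simp)
  ultimately have "((\<lambda>s. F1 (s, Y s, w s)) \<longlongrightarrow> F1 (t, Y t, w t)) (at t)"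
    using subsetD[OF box_orthant box_limit[OF less_imp_le[OF assms(1)] order_refl]]
    by (intro continuous_on_tendsto_compose[OF F1_cont])
  then have "(K \<longlongrightarrow> F1 (t, Y t, w t)) (at t)"
    by (rule Lim_transform_eventually) (use ev in \<open>auto elim: eventually_mono simp: K_def\<close>)
  then show ?thesis using assms by (simp add: isCont_def K_def)
qed

lemma K_nonneg: "0 \<le> K t"
proof -
  have a: "(\<bar>t\<bar>, Y \<bar>t\<bar>, w \<bar>t\<bar>) \<in> orthant3"
    by (rule subsetD[OF box_orthant box_limit[OF abs_ge_zero order_refl]])
  \<comment> \<open>Nonnegativity of \<open>F1\<close> is inherited pointwise; a single point is a
    compact set to which the local uniform convergence applies.\<close>
  have "(\<lambda>j. F j (\<bar>t\<bar>, Y \<bar>t\<bar>, w \<bar>t\<bar>)) \<longlonglongrightarrow> K t"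
    unfolding K_def by (rule tendsto_uniform_limitI[OF F_lim[of "{(\<bar>t\<bar>, Y \<bar>t\<bar>, w \<bar>t\<bar>)}"]]) (use a in auto)
  then show ?thesis
    by (rule LIMSEQ_le_const) (use F_nonneg a in blast)
qed

lemma b_tendsto: "b \<longlonglongrightarrow> 0"
proof -
  have "(\<lambda>j. q j - 1) \<longlonglongrightarrow> 1 - 1" by (intro tendsto_intros q)
  then show ?thesis
    using b by (intro tendsto_sandwich[OF _ _ tendsto_const, of 0 b sequentially "\<lambda>j. q j - 1"]) auto
qed

text \<open>The triples of time, profile and slope converge inside one box, so the nonlinearity
  passes to the limit. The weight tends to 1, because its base converges to a number at least 1 and
  its exponent to 0.\<close>

lemma \<kappa>_tendsto:
  assumes "0 < t" "t \<notin> D"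
  shows "(\<lambda>j. \<kappa> j t) \<longlonglongrightarrow> K t"
proof -
  have "(\<lambda>j. (t, y j t, v j t)) \<longlonglongrightarrow> (t, Y t, w t)"
    using assms by (intro tendsto_intros y_tendsto v_tendsto) auto
  then have "(\<lambda>j. F j (t, y j t, v j t)) \<longlonglongrightarrow> F1 (t, Y t, w t)"
    using assms
    by (intro uniform_limit_compose_tendsto[OF F_lim[OF box_compact box_orthant]
          continuous_on_subset[OF F1_cont box_orthant], of _ _ t]) (auto intro!: box_limit box_approx)
  moreover have "(\<lambda>j. y j t powr (- b j)) \<longlonglongrightarrow> Y t powr (- 0)"
    using assms Y_ge_1[of t] by (intro tendsto_intros y_tendsto b_tendsto) auto
  ultimately have "(\<lambda>j. F j (t, y j t, v j t) * y j t powr (- b j)) \<longlonglongrightarrow> F1 (t, Y t, w t) * Y t powr (- 0)"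
    by (rule tendsto_mult)
  then show ?thesis
    using assms Y_ge_1[of t] by (simp add: \<kappa>_def k_fun_def v_def K_def max_def)
qed

lemma AE_\<kappa>_tendsto: "AE t in lborel. 0 < t \<longrightarrow> (\<lambda>j. \<kappa> j t) \<longlonglongrightarrow> K t"
  using AE_notin_D by (rule eventually_mono) (simp add: \<kappa>_tendsto)

lemma \<kappa>_uniformly_locally_bounded: "uniformly_locally_bounded \<kappa>"
  unfolding uniformly_locally_bounded_def
proof
  fix R :: real
  show "\<exists>B. \<forall>j x. \<bar>x\<bar> \<le> R \<longrightarrow> \<bar>\<kappa> j x\<bar> \<le> B"
  proof (rule uniformly_bounded_if_eventually)
    fix j
    have "bounded (\<kappa> j ` {-R..R})"
      by (intro compact_imp_bounded compact_continuous_image continuous_on_subset[OF \<kappa>_continuous]) auto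
    then obtain B where B: "\<And>z. z \<in> \<kappa> j ` {-R..R} \<Longrightarrow> norm z \<le> B"
      unfolding bounded_iff by blast
    have "\<bar>\<kappa> j x\<bar> \<le> B" if "\<bar>x\<bar> \<le> R" for x
    proof -
      have "x \<in> {-R..R}" using that unfolding atLeastAtMost_iff by linarith
      then show ?thesis using B[OF imageI] by simp
    qed
    then show "\<exists>B. \<forall>x. \<bar>x\<bar> \<le> R \<longrightarrow> \<bar>\<kappa> j x\<bar> \<le> B" by blast
  next
    obtain B where B: "\<And>a. a \<in> box R \<Longrightarrow> \<bar>F1 a\<bar> \<le> B" using F1_bounded_box by blast
    \<comment> \<open>Eventually the nonlinearity is within 1 of \<open>F1\<close> on the box,
      whence the bound \<open>B + 1\<close>; the weight does not enlarge it, since profiles are at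
      least 1 and exponents nonpositive.\<close>
    have "\<forall>\<^sub>F j in sequentially. \<forall>a\<in>box R. dist (F j a) (F1 a) < 1"
      by (rule uniform_limitD[OF F_lim[OF box_compact box_orthant]]) simp
    then have "\<forall>\<^sub>F j in sequentially. \<forall>x. \<bar>x\<bar> \<le> R \<longrightarrow> \<bar>\<kappa> j x\<bar> \<le> B + 1"
    proof eventually_elim
      case (elim j)
      show ?case
      proof (intro allI impI)
        fix x :: real assume x: "\<bar>x\<bar> \<le> R"
        let ?t = "max 0 x"
        have t: "0 \<le> ?t" "?t \<le> R" using x by auto
        have a: "(?t, y j ?t, v j ?t) \<in> box R" by (rule box_approx[OF t])
        have "dist (F j (?t, y j ?t, v j ?t)) (F1 (?t, y j ?t, v j ?t)) < 1"
          using elim a by blast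
        then have F: "\<bar>F j (?t, y j ?t, v j ?t)\<bar> \<le> B + 1"
          using B[OF a] unfolding dist_real_def by linarith
        have "y j ?t powr (- b j) \<le> 1"
          using y_bounds(1)[OF t(1), of j] b(1)[of j] using powr_mono[of "- b j" 0 "y j ?t"] by simp
        then have "\<bar>F j (?t, y j ?t, v j ?t) * y j ?t powr (- b j)\<bar> \<le> (B + 1) * 1"
          unfolding abs_mult using F by (intro mult_mono) auto
        then show "\<bar>\<kappa> j x\<bar> \<le> B + 1" by (simp add: \<kappa>_def k_fun_def v_def)
      qed
    qed
    then show "\<exists>B. \<forall>\<^sub>F j in sequentially. \<forall>x. \<bar>x\<bar> \<le> R \<longrightarrow> \<bar>\<kappa> j x\<bar> \<le> B" by blast
  qed (meson order_trans)
qed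

lemma \<kappa>_borel: "\<kappa> j \<in> borel_measurable borel"
  by (rule borel_measurable_continuous_onI[OF \<kappa>_continuous])

lemma G_uniform_limit: "uniform_limit {0..R} (\<lambda>j. G_fun (F j) (b j) (y j)) G sequentially"
proof -
  have "uniform_limit {0..R} (\<lambda>j t. integral {0..t} (\<kappa> j)) (\<lambda>t. integral {0..t} K) sequentially"
    by (rule uniform_limit_integral[OF \<kappa>_borel \<kappa>_uniformly_locally_bounded K_borel K_locally_bounded
          AE_\<kappa>_tendsto])
  moreover have "integral {0..t} (\<kappa> j) = G_fun (F j) (b j) (y j) t" for j t
    unfolding G_fun_def by (intro integral_cong) (auto simp: \<kappa>_def)
  ultimately show ?thesis by (simp add: G_def[abs_def])
qed

lemma G_tendsto: "0 \<le> t \<Longrightarrow> (\<lambda>j. v j t powr (q j - 1)) \<longlonglongrightarrow> G t"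
proof -
  assume t: "0 \<le> t"
  have "(\<lambda>j. G_fun (F j) (b j) (y j) t) \<longlonglongrightarrow> G t"
    by (rule tendsto_uniform_limitI[OF G_uniform_limit[of t]]) (use t in simp)
  then show ?thesis using t by (simp add: profile(5) v_def max_def)
qed

section \<open>The limit flux and complementarity\<close>

lemma G_0: "G 0 = 0"
  by (simp add: G_def)

lemma G_nonneg: "0 \<le> G t"
  unfolding G_def by (intro integral_nonneg locally_bounded_integrable_on K_borel K_locally_bounded K_nonneg)

lemma G_mono: "s \<le> t \<Longrightarrow> G s \<le> G t"
  unfolding G_def
  by (intro integral_subset_le locally_bounded_integrable_on K_borel K_locally_bounded) (auto simp: K_nonneg)

lemma q_minus_1: "(\<lambda>j. q j - 1) \<longlonglongrightarrow> 0"
  using tendsto_diff[OF q(2) tendsto_const[of 1]] by simp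

text \<open>Slopes are bounded by \<open>\<xi>2\<close>, which may exceed 1, so this bound is gained
  only in the limit: \<open>\<xi>2 powr (q j - 1)\<close> tends to 1.\<close>

lemma G_le_1: "0 \<le> t \<Longrightarrow> G t \<le> 1"
proof -
  assume "0 \<le> t"
  have "(\<lambda>j. \<xi>2 powr (q j - 1)) \<longlonglongrightarrow> \<xi>2 powr 0"
    using parameters by (intro tendsto_intros q_minus_1) auto
  then have "(\<lambda>j. \<xi>2 powr (q j - 1)) \<longlonglongrightarrow> 1" using parameters by simp
  then show ?thesis
    by (rule LIMSEQ_le[OF G_tendsto[OF \<open>0 \<le> t\<close>]])
      (use v_bounds q(1) in \<open>auto intro!: powr_mono2 simp: less_imp_le\<close>)
qed

lemma complementarity:
  assumes "0 \<le> t" "t \<notin> D"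
  shows "(1 - G t) * w t = 0"
proof (cases "w t = 0")
  case False
  have "(\<lambda>j. v j t powr (q j - 1)) \<longlonglongrightarrow> w t powr 0"
    using False assms by (intro tendsto_intros v_tendsto q_minus_1) auto
  then have "G t = 1"
    using LIMSEQ_unique[OF G_tendsto[OF assms(1)]] False by simp
  then show ?thesis by simp
qed simp

lemma G_deriv: "0 < t \<Longrightarrow> t \<notin> D \<Longrightarrow> (G has_field_derivative K t) (at t)"
  by (rule primitive_has_deriv[OF K_borel K_locally_bounded _ countable_D K_isCont, where c = 0])
    (auto simp: G_def)

lemma K_eq_0:
  assumes "0 < t" "t \<notin> D" "G t = 1"
  shows "K t = 0"
  \<comment> \<open>The radius of the neighbourhood is \<open>t\<close> itself, which keeps it
    inside the positive half-line, where \<open>G\<close> is at most 1.\<close>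
  using DERIV_local_max[OF G_deriv[OF assms(1,2)] assms(1)] G_le_1 assms(3) by auto

lemma w_eq_0: "0 \<le> t \<Longrightarrow> t \<notin> D \<Longrightarrow> G t < 1 \<Longrightarrow> w t = 0"
  using complementarity[of t] by auto

text \<open>Since \<open>G\<close> is nondecreasing, it stays below 1 on all of [0, t];
  complementarity then removes the slope off \<open>D\<close>.\<close>

lemma Y_eq_1:
  assumes "0 \<le> t" "G t < 1"
  shows "Y t = 1"
proof -
  have "integral {0..t} w = integral {0..t} (\<lambda>_. 0)"
  proof (rule integral_spike)
    show "negligible D"
      unfolding negligible_iff_null_sets
      by (rule null_sets_completionI[OF countable_imp_null_set_lborel[OF countable_D]])
    show "0 = w s" if "s \<in> {0..t} - D" for s
      using w_eq_0[of s] le_less_trans[OF G_mono[of s t] assms(2)] that by auto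
  qed
  then show ?thesis by (simp add: Y_def)
qed

lemma G_times_Y: "0 \<le> t \<Longrightarrow> G t * Y t = G t + (Y t - 1)"
  using G_le_1[of t] Y_eq_1[of t] by (cases "G t < 1") auto

lemma Y_times_K: "0 < t \<Longrightarrow> t \<notin> D \<Longrightarrow> Y t * K t = K t"
  using G_le_1[of t] Y_eq_1[of t] K_eq_0[of t] by (cases "G t < 1") auto

lemma G_even: "lipschitz_primitive (\<lambda>x. G \<bar>x\<bar>) (\<lambda>x. sgn x * K \<bar>x\<bar>)"
  by (rule lipschitz_primitive_even[OF K_borel K_locally_bounded _ countable_D K_isCont, where c = 0])
    (auto simp: G_def)

lemma G_odd: "lipschitz_primitive (\<lambda>x. sgn x * G \<bar>x\<bar>) (\<lambda>x. K \<bar>x\<bar>)"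
  using lipschitz_primitive_odd[OF K_borel K_locally_bounded _ countable_D K_isCont, where c = 0 and f = G]
  by (auto simp: G_def)

lemma weakstar_hderiv: "weakstar_loc {0<..} (\<lambda>j. hderiv (y j)) w"
  by (rule weakstar_loc_dominated[OF v_borel v_uniformly_locally_bounded w_borel w_locally_bounded
        AE_v_tendsto]) (simp add: v_def)

lemma weakstar_k_fun: "weakstar_loc {0<..} (\<lambda>j. k_fun (F j) (b j) (y j)) K"
  by (rule weakstar_loc_dominated[OF \<kappa>_borel \<kappa>_uniformly_locally_bounded K_borel K_locally_bounded
        AE_\<kappa>_tendsto]) (simp add: \<kappa>_def)

text \<open>The logarithm of the slope is \<open>ln\<close> of the flux divided by
  \<open>q j - 1\<close>. The flux tends to 1, where \<open>ln z\<close> behaves like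
  \<open>z - 1\<close>, so this quotient has the same limit as the given one.\<close>

lemma exp_limit:
  assumes t: "0 \<le> t" "t \<notin> D" "G t = 1"
    and a: "(\<lambda>j. (G_fun (F j) (b j) (y j) t - 1) / (q j - 1)) \<longlonglongrightarrow> a"
  shows "w t = exp a"
proof -
  have G: "G_fun (F j) (b j) (y j) t = v j t powr (q j - 1)" for j
    using t(1) by (simp add: profile(5) v_def max_def)
  have "(ln has_field_derivative inverse 1) (at (1::real))" by (rule DERIV_ln) simp
  \<comment> \<open>Caratheodory's form of the derivative replaces the quotient of
    \<open>ln z\<close> by \<open>z - 1\<close>, so no case distinction is needed when the flux
    equals 1.\<close>
  then obtain h where h: "\<And>z :: real. ln z - ln 1 = h z * (z - 1)" "isCont h 1" "h 1 = inverse 1"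
    unfolding CARAT_DERIV by blast
  have lim1: "(\<lambda>j. v j t powr (q j - 1)) \<longlonglongrightarrow> 1" using G_tendsto[OF t(1)] t(3) by simp
  \<comment> \<open>A zero slope would give zero flux, which is excluded once the flux is close to
    1.\<close>
  have pos: "\<forall>\<^sub>F j in sequentially. 0 < v j t"
    using order_tendstoD(1)[OF lim1 zero_less_one]
  proof (rule eventually_mono)
    show "0 < v j t" if "0 < v j t powr (q j - 1)" for j
      using that v_bounds(1)[of j t] by (cases "v j t = 0") auto
  qed
  have "(\<lambda>j. h (v j t powr (q j - 1))) \<longlonglongrightarrow> h 1"
    by (rule isCont_tendsto_compose[OF h(2) lim1])
  from tendsto_mult[OF this a]
  have "(\<lambda>j. h (v j t powr (q j - 1)) * ((v j t powr (q j - 1) - 1) / (q j - 1))) \<longlonglongrightarrow> a"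
    by (simp add: G h(3))
  moreover have "h (v j t powr (q j - 1)) * ((v j t powr (q j - 1) - 1) / (q j - 1)) = ln (v j t)"
    if "0 < v j t" for j
    using h(1)[of "v j t powr (q j - 1)"] that q(1)[of j] by (simp add: ln_powr divide_simps mult.commute)
  then have "\<forall>\<^sub>F j in sequentially.
      h (v j t powr (q j - 1)) * ((v j t powr (q j - 1) - 1) / (q j - 1)) = ln (v j t)"
    using pos by (rule eventually_mono[rotated])
  ultimately have "(\<lambda>j. ln (v j t)) \<longlonglongrightarrow> a"
    by (rule Lim_transform_eventually)
  then have "(\<lambda>j. exp (ln (v j t))) \<longlonglongrightarrow> exp a" by (rule tendsto_exp)
  then have "(\<lambda>j. v j t) \<longlonglongrightarrow> exp a"
    by (rule Lim_transform_eventually) (use pos in \<open>auto elim: eventually_mono\<close>)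
  then show ?thesis using LIMSEQ_unique v_tendsto[OF t(2)] by blast
qed

section \<open>The 1-Laplace equation for the limit\<close>

lemma AE_pointwise: "AE x in lborel. x \<noteq> 0 \<and> \<bar>x\<bar> \<notin> D"
proof -
  have "AE x in lborel. x \<notin> insert 0 (D \<union> uminus ` D)"
    using countable_D by (intro AE_not_in countable_imp_null_set_lborel) auto
  then show ?thesis
    by (rule eventually_mono) (auto simp: abs_if image_iff split: if_splits dest: minus_equation_iff[THEN iffD1])
qed

lemma sgn_w_bounds: "0 \<le> sgn x * (sgn x * w \<bar>x\<bar>)" "\<bar>sgn x * w \<bar>x\<bar>\<bar> \<le> \<xi>2"
  using w_bounds[of "\<bar>x\<bar>"] parameters by (auto simp: sgn_if)

lemma one_laplacian_field_limit:
  "one_laplacian_field (\<lambda>x. sgn x * G \<bar>x\<bar>) (\<lambda>x. Y \<bar>x\<bar>) (\<lambda>x. K \<bar>x\<bar>)"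
  unfolding one_laplacian_field_def
proof (intro conjI allI impI)
  show "Linf_loc UNIV (\<lambda>x. sgn x * G \<bar>x\<bar>)" "Linf_loc UNIV (\<lambda>x. K \<bar>x\<bar>)"
    using lipschitz_primitiveD[OF G_odd] by (auto intro: Linf_loc_locally_bounded)
  show "weak_deriv UNIV (\<lambda>x. sgn x * G \<bar>x\<bar>) (\<lambda>x. K \<bar>x\<bar>)"
    by (rule lipschitz_primitive_weak_deriv[OF G_odd])
  have "\<bar>sgn x * G \<bar>x\<bar>\<bar> \<le> 1" for x
    using G_nonneg[of "\<bar>x\<bar>"] G_le_1[of "\<bar>x\<bar>"] by (auto simp: sgn_if)
  then show "AE x in lebesgue. \<bar>sgn x * G \<bar>x\<bar>\<bar> \<le> 1" by simp
next
  fix \<zeta> assume \<zeta>: "test_fun UNIV \<zeta>"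
  have [measurable]: "\<zeta> \<in> borel_measurable borel"
    using test_fun_continuous[OF \<zeta>, of UNIV] by (auto intro: borel_measurable_continuous_onI)
  have Kb: "(\<lambda>x. K \<bar>x\<bar>) \<in> borel_measurable borel" "locally_bounded (\<lambda>x. K \<bar>x\<bar>)"
    by (rule lipschitz_primitiveD[OF G_odd])+
  have wb: "(\<lambda>x. w \<bar>x\<bar>) \<in> borel_measurable borel" "locally_bounded (\<lambda>x. w \<bar>x\<bar>)"
    by (rule lipschitz_primitiveD[OF Y_odd])+
  have [measurable]: "(\<lambda>x. Y \<bar>x\<bar>) \<in> borel_measurable borel" "(\<lambda>x. sgn x * w \<bar>x\<bar>) \<in> borel_measurable borel"
    by (rule lipschitz_primitiveD[OF Y_even])+
  note [measurable] = Kb(1) wb(1)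
  have "(\<integral>x. Y \<bar>x\<bar> * \<zeta> x * K \<bar>x\<bar> \<partial>lebesgue) = (\<integral>x. Y \<bar>x\<bar> * \<zeta> x * K \<bar>x\<bar> \<partial>lborel)"
    by (rule integral_completion) measurable
  also have "\<dots> = (\<integral>x. K \<bar>x\<bar> * \<zeta> x \<partial>lborel)"
  proof (rule integral_cong_AE)
    show "AE x in lborel. Y \<bar>x\<bar> * \<zeta> x * K \<bar>x\<bar> = K \<bar>x\<bar> * \<zeta> x"
      using AE_pointwise
    proof eventually_elim
      case (elim x)
      then have "Y \<bar>x\<bar> * K \<bar>x\<bar> = K \<bar>x\<bar>" by (intro Y_times_K) auto
      then show ?case by (metis mult.assoc mult.commute)
    qed
  qed measurable
  finally have 1: "(\<integral>x. Y \<bar>x\<bar> * \<zeta> x * K \<bar>x\<bar> \<partial>lebesgue) = (\<integral>x. K \<bar>x\<bar> * \<zeta> x \<partial>lborel)" .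
  have "Y \<bar>x\<bar> * (sgn x * G \<bar>x\<bar>) = sgn x * (G \<bar>x\<bar> * Y \<bar>x\<bar>)" for x
    by (simp add: mult_ac)
  then have "Y \<bar>x\<bar> * (sgn x * G \<bar>x\<bar>) = sgn x * G \<bar>x\<bar> + sgn x * (Y \<bar>x\<bar> - 1)" for x
    by (simp only: G_times_Y abs_ge_zero distrib_left)
  then have "(\<integral>x. Y \<bar>x\<bar> * (sgn x * G \<bar>x\<bar>) * deriv \<zeta> x \<partial>lebesgue) = - (\<integral>x. (K \<bar>x\<bar> + w \<bar>x\<bar>) * \<zeta> x \<partial>lborel)"
    using lipschitz_primitive_by_parts[OF lipschitz_primitive_add[OF G_odd Y_odd] \<zeta>] by simp
  also have "(\<integral>x. (K \<bar>x\<bar> + w \<bar>x\<bar>) * \<zeta> x \<partial>lborel) = (\<integral>x. K \<bar>x\<bar> * \<zeta> x \<partial>lborel) + (\<integral>x. w \<bar>x\<bar> * \<zeta> x \<partial>lborel)"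
    unfolding distrib_right
    by (rule Bochner_Integration.integral_add[OF integrable_mult_test_fun[OF Kb \<zeta>] integrable_mult_test_fun[OF wb \<zeta>]])
  \<comment> \<open>The two contributions of \<open>K\<close> cancel: one comes from the derivative
    of \<open>z\<close>, the other from the derivative of the linearised product.\<close>
  finally have 2: "pairing (\<lambda>x. sgn x * G \<bar>x\<bar>) (\<lambda>x. K \<bar>x\<bar>) (\<lambda>x. Y \<bar>x\<bar>) \<zeta> = (\<integral>x. w \<bar>x\<bar> * \<zeta> x \<partial>lborel)"
    by (simp add: pairing_def 1)
  have "(LINT x|total_variation_measure (\<lambda>x. Y \<bar>x\<bar>). \<zeta> x) = (\<integral>x. \<bar>sgn x * w \<bar>x\<bar>\<bar> *\<^sub>R \<zeta> x \<partial>lborel)"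
    unfolding total_variation_measure_lipschitz_primitive[OF Y_even sgn_w_bounds]
    by (rule integral_density) auto
  also have "\<dots> = (\<integral>x. w \<bar>x\<bar> * \<zeta> x \<partial>lborel)"
  proof (rule integral_cong_AE)
    show "AE x in lborel. \<bar>sgn x * w \<bar>x\<bar>\<bar> *\<^sub>R \<zeta> x = w \<bar>x\<bar> * \<zeta> x"
      using AE_pointwise by eventually_elim (auto simp: abs_mult abs_sgn_eq w_bounds)
  qed measurable
  finally show "pairing (\<lambda>x. sgn x * G \<bar>x\<bar>) (\<lambda>x. K \<bar>x\<bar>) (\<lambda>x. Y \<bar>x\<bar>) \<zeta>
      = (LINT x|total_variation_measure (\<lambda>x. Y \<bar>x\<bar>). \<zeta> x)"
    using 2 by simp
qed

lemma BV_loc_limit: "BV_loc (\<lambda>x. Y \<bar>x\<bar>)"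
  unfolding BV_loc_def
proof (intro conjI allI impI)
  show "L1_loc UNIV (\<lambda>x. Y \<bar>x\<bar>)"
    using lipschitz_primitiveD[OF Y_even] by (auto intro: L1_loc_locally_bounded)
  fix V assume V: "compactly_inside V UNIV"
  then have "open V" by (simp add: compactly_inside_def)
  note [measurable] = borel_open[OF this]
  have "variation (\<lambda>x. Y \<bar>x\<bar>) V = (\<integral>\<^sup>+x\<in>V. ennreal \<bar>sgn x * w \<bar>x\<bar>\<bar> \<partial>lborel)"
    by (rule variation_lipschitz_primitive[OF Y_even sgn_w_bounds(1) \<open>open V\<close>])
  also have "\<dots> \<le> (\<integral>\<^sup>+x\<in>V. ennreal \<xi>2 \<partial>lborel)"
    by (intro nn_integral_mono mult_right_mono ennreal_leI sgn_w_bounds) simp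
  also have "\<dots> = ennreal \<xi>2 * emeasure lborel V"
    by (simp add: nn_integral_cmult_indicator)
  also have "\<dots> < \<infinity>"
    using emeasure_bounded_finite[OF compactly_insideD(2)[OF V]] by (auto simp: ennreal_mult_less_top)
  finally show "variation (\<lambda>x. Y \<bar>x\<bar>) V < \<infinity>" .
qed

lemma one_laplacian_limit: "one_laplacian (\<lambda>x. Y \<bar>x\<bar>) (\<lambda>x. K \<bar>x\<bar>)"
  unfolding one_laplacian_def
  using BV_loc_limit one_laplacian_field_limit lipschitz_primitiveD[OF Y_even]
  by (auto intro: Linf_loc_locally_bounded)

section \<open>The set where the flux is saturated\<close>

definition C1 :: "real set" where "C1 = {t. 0 < t \<and> G t = 1}"

lemma C1_bdd_below: "bdd_below C1"
  unfolding C1_def by (auto intro: bdd_belowI[of _ 0])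

lemma G_before_C1:
  assumes "0 \<le> t" "t < Inf C1"
  shows "G t < 1"
proof (rule ccontr)
  assume "\<not> G t < 1"
  then have "G t = 1" using G_le_1[OF assms(1)] by simp
  then have "t \<in> C1" using assms(1) G_0 by (cases "t = 0") (auto simp: C1_def)
  then show False using cInf_lower[OF _ C1_bdd_below, of t] assms(2) by simp
qed

lemma Inf_C1_nonneg: "C1 \<noteq> {} \<Longrightarrow> 0 \<le> Inf C1"
  by (rule cInf_greatest) (auto simp: C1_def)

text \<open>Monotonicity and the upper bound 1 settle every point beyond the infimum; the infimum
  itself, which need not be known to lie in \<open>C1\<close>, follows by continuity from the
  right.\<close>

lemma G_after_C1:
  assumes "C1 \<noteq> {}" "Inf C1 \<le> t"
  shows "G t = 1"
proof -
  have gt: "G s = 1" if "Inf C1 < s" for s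
  proof -
    have "\<exists>r\<in>C1. r < s"
      using that cInf_less_iff[OF assms(1) C1_bdd_below, of s] by simp
    then obtain r where r: "0 < r" "G r = 1" "r < s" by (auto simp: C1_def)
    then show ?thesis
      using G_mono[of r s] G_le_1[of s] by simp
  qed
  have "continuous_on UNIV (\<lambda>x. G \<bar>x\<bar>)"
    using G_even by (auto simp: lipschitz_primitive_def intro: locally_lipschitz_continuous)
  then have "isCont (\<lambda>x. G \<bar>x\<bar>) t"
    by (simp add: continuous_on_eq_continuous_at)
  then have "((\<lambda>x. G \<bar>x\<bar>) \<longlongrightarrow> G \<bar>t\<bar>) (at_right t)"
    by (simp add: isCont_def filterlim_at_split)
  moreover have "eventually (\<lambda>x. G \<bar>x\<bar> = 1) (at_right t)"
    using eventually_at_right_less[of t]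
    by eventually_elim (use Inf_C1_nonneg[OF assms(1)] assms(2) gt in simp)
  ultimately have "G \<bar>t\<bar> = 1"
    using tendsto_unique[OF trivial_limit_at_right_real, of "\<lambda>x. G \<bar>x\<bar>" "G \<bar>t\<bar>" t 1]
    by (simp add: tendsto_eventually)
  then show ?thesis using Inf_C1_nonneg[OF assms(1)] assms(2) by simp
qed

lemma AE_lebesgue_notin_D: "AE t in lebesgue. t \<notin> D"
  by (rule AE_completion[OF AE_notin_D])

lemma AE_complementarity: "AE t\<in>{0<..} in lebesgue. (1 - G t) * w t = 0"
  using AE_lebesgue_notin_D by eventually_elim (simp add: complementarity)

lemma AE_before_C1:
  assumes "0 < r" "G r < 1"
  shows "AE t\<in>{0<..<r} in lebesgue. Y t = 1 \<and> K t = F1 (t, 1, 0)"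
  using AE_lebesgue_notin_D
proof eventually_elim
  case (elim t)
  show ?case
  proof
    assume t: "t \<in> {0<..<r}"
    then have "G t < 1" using G_mono[of t r] assms(2) by simp
    then show "Y t = 1 \<and> K t = F1 (t, 1, 0)"
      using t elim Y_eq_1[of t] w_eq_0[of t] by (simp add: K_def)
  qed
qed

lemma AE_after_C1:
  assumes "C1 \<noteq> {}"
  shows "AE t\<in>{Inf C1<..} in lebesgue. K t = 0"
  using AE_lebesgue_notin_D
  by eventually_elim (use Inf_C1_nonneg[OF assms] G_after_C1[OF assms] in \<open>auto intro: K_eq_0\<close>)

lemma AE_exponential:
  assumes C1: "C1 \<noteq> {}" and E: "E \<subseteq> {Inf C1<..}"
    and a: "AE t\<in>E in lebesgue. (\<lambda>j. (G_fun (F j) (b j) (y j) t - 1) / (q j - 1)) \<longlonglongrightarrow> a t"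
  shows "AE t\<in>E in lebesgue. w t = exp (a t) \<and> F1 (t, Y t, w t) = 0"
  using AE_lebesgue_notin_D a
proof eventually_elim
  case (elim t)
  show ?case
  proof
    assume t: "t \<in> E"
    then have "Inf C1 < t" using E by auto
    then have pos: "0 < t" and G: "G t = 1"
      using Inf_C1_nonneg[OF C1] G_after_C1[OF C1, of t] by auto
    show "w t = exp (a t) \<and> F1 (t, Y t, w t) = 0"
      using exp_limit[of t "a t"] K_eq_0[of t] elim t pos G by (simp add: K_def)
  qed
qed

end

theorem proposition6p1:
  fixes l \<xi>1 \<xi>2 \<c> :: real
    and \<beta> :: "real \<Rightarrow> real"
    and F :: "real \<Rightarrow> real \<times> real \<times> real \<Rightarrow> real"
    and F1 :: "real \<times> real \<times> real \<Rightarrow> real"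
    and yp :: "real \<Rightarrow> real \<Rightarrow> real"
    and p :: "nat \<Rightarrow> real"
  assumes "0 \<le> l" and "1 \<le> \<xi>1" and "0 < \<xi>2"
    and "\<And>q. q \<in> {1<..<2} \<Longrightarrow> 0 \<le> \<beta> q \<and> \<beta> q \<le> q - 1"
    and "\<And>q. q \<in> {1<..<2} \<Longrightarrow> one_dim_admissible l \<xi>1 \<xi>2 q (F q)"
    and "\<exists>\<theta>. 0 < \<theta> \<and> \<theta> \<le> 1 \<and> holder_loc \<theta> orthant3 F1"
    and "locally_uniform_limit orthant3 F F1 (at_right 1)"
    and "\<c> \<in> {0..1}" and "((\<lambda>q. \<beta> q / (q - 1)) \<longlongrightarrow> \<c>) (at_right 1)"
    and "\<And>q. q \<in> {1<..<2} \<Longrightarrow> solution_profile l \<xi>1 \<xi>2 q (\<beta> q) (F q) (yp q)"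
    and "\<And>j. p j \<in> {1<..<2}" and "p \<longlonglongrightarrow> 1"
  defines "kp \<equiv> \<lambda>q. k_fun (F q) (\<beta> q) (yp q)"
    and "Gp \<equiv> \<lambda>q. G_fun (F q) (\<beta> q) (yp q)"
  shows
    "\<exists>(\<sigma> :: nat \<Rightarrow> nat) y dy G dG K.
       strict_mono \<sigma> \<and>
       W1inf_loc_halfline y \<and> weak_deriv {0<..} y dy \<and>
       W1inf_loc_halfline G \<and> weak_deriv {0<..} G dG \<and>
       Linf_loc_halfline K \<and>

       \<comment> \<open>(i)\<close>
       locally_uniform_limit {0..} (\<lambda>j. yp (p (\<sigma> j))) y sequentially \<and>
       weakstar_loc {0<..} (\<lambda>j. hderiv (yp (p (\<sigma> j)))) dy \<and>
       locally_uniform_limit {0..} (\<lambda>j. Gp (p (\<sigma> j))) G sequentially \<and>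
       weakstar_loc {0<..} (\<lambda>j. kp (p (\<sigma> j))) K \<and>
       (AE t\<in>{0<..} in lebesgue. dG t = K t \<and> K t \<ge> 0) \<and>
       G 0 = 0 \<and> (\<forall>t\<ge>0. 0 \<le> G t \<and> G t \<le> 1) \<and>
       (AE t\<in>{0<..} in lebesgue. (1 - G t) * dy t = 0) \<and>

       (let C1 = {t. t > 0 \<and> G t = 1} in
         \<comment> \<open>(ii)\<close>
         (C1 \<noteq> {} \<longrightarrow>
            (\<forall>t. 0 \<le> t \<and> t < Inf C1 \<longrightarrow> G t < 1) \<and> (\<forall>t\<ge>Inf C1. G t = 1)) \<and>
         (\<forall>r>0. G r < 1 \<longrightarrow>
            (AE t\<in>{0<..<r} in lebesgue. y t = 1 \<and> K t = dG t \<and> dG t = F1 (t, 1, 0))) \<and>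
         (C1 \<noteq> {} \<longrightarrow> (AE t\<in>{Inf C1<..} in lebesgue. K t = 0)) \<and>
         one_laplacian_field (\<lambda>x. sgn x * G \<bar>x\<bar>) (\<lambda>x. y \<bar>x\<bar>) (\<lambda>x. K \<bar>x\<bar>) \<and>
         one_laplacian (\<lambda>x. y \<bar>x\<bar>) (\<lambda>x. K \<bar>x\<bar>) \<and>

         \<comment> \<open>(iii)\<close>
         (C1 \<noteq> {} \<longrightarrow>
            (\<forall>E a. E \<in> sets lebesgue \<and> E \<subseteq> {Inf C1<..} \<and>
               (AE t\<in>E in lebesgue.
                  (\<lambda>j. (Gp (p (\<sigma> j)) t - 1) / (p (\<sigma> j) - 1)) \<longlonglongrightarrow> a t) \<longrightarrow>
               (AE t\<in>E in lebesgue. dy t = exp (a t) \<and> F1 (t, y t, dy t) = 0))))"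
proof -
  have sol: "solution_profile l \<xi>1 \<xi>2 (p j) (\<beta> (p j)) (F (p j)) (yp (p j))"
    and F_nonneg: "\<forall>a\<in>orthant3. 0 \<le> F (p j) a" and p: "1 < p j" for j
    using assms(5)[OF assms(11)[of j]] assms(10)[OF assms(11)[of j]] assms(11)[of j]
    by (auto simp: one_dim_admissible_def)
  note profile = solution_profile_properties[OF sol p F_nonneg]
  \<comment> \<open>Helly's theorem concerns right-continuous monotone functions on the line.
    Freezing the slope for negative times preserves continuity, monotonicity and the bound
    \<open>\<xi>2\<close>.\<close>
  define f where "f j t = hderiv (yp (p j)) (max 0 t)" for j t
  have "continuous (at_right x) (f j)" for x j
  proof -
    have "continuous_on UNIV (f j)"
      unfolding f_def
      by (rule continuous_on_compose2[OF profile(1)]) (auto intro!: continuous_intros)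
    then show ?thesis
      by (meson UNIV_I continuous_on_eq_continuous_within continuous_within_subset subset_UNIV)
  qed
  moreover have "mono (f j)" for j
    unfolding f_def by (intro monoI mono_onD[OF profile(6)]) auto
  moreover have "\<bar>f j t\<bar> \<le> \<xi>2" for j t
    using sol[of j] by (auto simp: f_def solution_profile_def)
  ultimately obtain \<sigma> w where \<sigma>: "strict_mono (\<sigma> :: nat \<Rightarrow> nat)" and w: "mono w"
    and lim: "\<And>t. isCont w t \<Longrightarrow> (\<lambda>j. f (\<sigma> j) t) \<longlonglongrightarrow> w t"
    using Helly_selection[of f \<xi>2] by blast
  have p\<sigma>: "(\<lambda>j. p (\<sigma> j)) \<longlonglongrightarrow> 1"
    using LIMSEQ_subseq_LIMSEQ[OF assms(12) \<sigma>] by (simp add: comp_def)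
  \<comment> \<open>The exponents approach 1 from above, so limits along \<open>at_right 1\<close>
    can be pulled back to the selected sequence.\<close>
  then have p\<sigma>': "filterlim (\<lambda>j. p (\<sigma> j)) (at_right 1) sequentially"
    by (rule tendsto_imp_filterlim_at_right) (simp add: p)
  have F1: "continuous_on orthant3 F1"
    using assms(6) by (auto intro!: holder_loc_continuous_on closed_Times)
  interpret p_to_1_limit l \<xi>1 \<xi>2 "\<lambda>j. p (\<sigma> j)" "\<lambda>j. \<beta> (p (\<sigma> j))" "\<lambda>j. F (p (\<sigma> j))" F1
    "\<lambda>j. yp (p (\<sigma> j))" w
  proof
    show "uniform_limit C (\<lambda>j. F (p (\<sigma> j))) F1 sequentially" if "compact C" "C \<subseteq> orthant3" for C
      using assms(7) that unfolding locally_uniform_limit_def by (blast intro: filterlim_compose[OF _ p\<sigma>'])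
    show "(\<lambda>j. hderiv (yp (p (\<sigma> j))) (max 0 t)) \<longlonglongrightarrow> w t" if "isCont w t" for t
      using lim[OF that] by (simp add: f_def)
  qed (use assms(1-3) assms(4)[OF assms(11)] p p\<sigma> F_nonneg F1 sol w in auto)
  have C1: "{t. t > 0 \<and> G t = 1} = C1" by (simp add: C1_def)
  have AE_K: "AE t\<in>{0<..} in lebesgue. K t = K t \<and> K t \<ge> 0"
    by (simp add: K_nonneg)
  have C1_G: "C1 \<noteq> {} \<longrightarrow> (\<forall>t. 0 \<le> t \<and> t < Inf C1 \<longrightarrow> G t < 1) \<and> (\<forall>t\<ge>Inf C1. G t = 1)"
    using G_before_C1 G_after_C1 by blast
  have expo: "C1 \<noteq> {} \<longrightarrow> (\<forall>E a. E \<in> sets lebesgue \<and> E \<subseteq> {Inf C1<..} \<and>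
     (AE t\<in>E in lebesgue. (\<lambda>j. (G_fun (F (p (\<sigma> j))) (\<beta> (p (\<sigma> j))) (yp (p (\<sigma> j))) t - 1) / (p (\<sigma> j) - 1)) \<longlonglongrightarrow> a t) \<longrightarrow>
     (AE t\<in>E in lebesgue. w t = exp (a t) \<and> F1 (t, Y t, w t) = 0))"
    using AE_exponential by blast
  have bounds: "\<forall>t\<ge>0. 0 \<le> G t \<and> G t \<le> 1"
    by (simp add: G_nonneg G_le_1)
  have before: "\<forall>r>0. G r < 1 \<longrightarrow> (AE t\<in>{0<..<r} in lebesgue. Y t = 1 \<and> K t = K t \<and> K t = F1 (t, 1, 0))"
    using AE_before_C1 by simp
  have after: "C1 \<noteq> {} \<longrightarrow> (AE t\<in>{Inf C1<..} in lebesgue. K t = 0)"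
    using AE_after_C1 by blast
  \<comment> \<open>The slope limit \<open>w\<close> is the weak derivative of \<open>Y\<close>, and
    \<open>K\<close> serves both as the weak derivative of \<open>G\<close> and as the limit
    density, which makes their equality trivial.\<close>
  show ?thesis
    unfolding Let_def kp_def Gp_def
    by (rule exI[of _ \<sigma>], rule exI[of _ Y], rule exI[of _ w], rule exI[of _ G], rule exI[of _ K],
        rule exI[of _ K], unfold C1, intro conjI)
      (rule \<sigma> halfline_W1inf(1)[OF Y_even] halfline_weak_deriv[OF Y_even order_refl]
        halfline_W1inf(1)[OF G_even] halfline_weak_deriv[OF G_even order_refl] halfline_W1inf(2)[OF G_even]
        locally_uniform_limit_halfline[OF y_uniform_limit] weakstar_hderiv
        locally_uniform_limit_halfline[OF G_uniform_limit] weakstar_k_fun AE_K G_0 bounds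
        AE_complementarity C1_G before after one_laplacian_field_limit one_laplacian_limit expo)+
qed

end
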